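(* Let $\overrightarrow{G}$ be a digraph without loops or parallel arcs on $n$ vertices, let $\beta,\gamma$ be real numbers and $H(\overrightarrow{G})=\beta D(\overrightarrow{G})+\gamma A(\overrightarrow{G})$. Let $k$ be an integer. (i) For every vertex $v$ of $\overrightarrow{G}$, \begin{eqnarray*} \Phi_k(H(\overrightarrow{G}),x) &=& (x-\beta d^{+}(v))[\Phi_{k-1}(H_v(\overrightarrow{G})) + \Phi_k(H_v(\overrightarrow{G}))] \\ && +\sum_{\overrightarrow{C}\in \mathcal{C}_{\overrightarrow{G}}(v)} \gamma^{|V(\overrightarrow{C})|}[(-1)^{|V(\overrightarrow{C})|}\Phi_{k-|V(\overrightarrow{C})|}(H_{V(\overrightarrow{C})}(\overrightarrow{G})) - \Phi_k(H_{V(\overrightarrow{C})}(\overrightarrow{G}))]. \end{eqnarray*} (ii) For every arc $\overrightarrow{e}=(v,u)$ of $\overrightarrow{G}$, \begin{eqnarray*} \Phi_k(H(\overrightarrow{G}),x) &=& \Phi_k(H(\overrightarrow{G}-\overrightarrow{e}),x) - \beta[\Phi_k(H_v(\overrightarrow{G}-\overrightarrow{e})) + \Phi_{k-1}(H_v(\overrightarrow{G}-\overrightarrow{e}))] \\ && + \sum_{\overrightarrow{C}\in \mathcal{C}_{\overrightarrow{G}}(\overrightarrow{e})} \gamma^{|V(\overrightarrow{C})|}[(-1)^{|V(\overrightarrow{C})|}\Phi_{k-|V(\overrightarrow{C})|}(H_{V(\overrightarrow{C})}(\overrightarrow{G})) - \Phi_k(H_{V(\overrightarrow{C})}(\overrightarrow{G}))].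 \end{eqnarray*}
   Context: For an $m\times m$ matrix $M=(m_{ij})$ and an integer $j$ with $1\le j\le m$, the hook immanant is $d_j(M)=\sum_{\sigma\in S_m}\chi_{(j,1^{m-j})}(\sigma)\prod_{i=1}^m m_{i\sigma(i)}$, where $\chi_{(j,1^{m-j})}$ is the irreducible character of $S_m$ indexed by the hook partition $(j,1^{m-j})$; by convention $d_j(M)=0$ if $j<1$ or $j>m$. The hook immanantal polynomial is $\Phi_j(M,x)=d_j(xI_m-M)$, abbreviated $\Phi_j(M)$. For a digraph $\overrightarrow{G}$ with vertices $v_1,\dots,v_n$, $A(\overrightarrow{G})=(a_{ij})$ with $a_{ij}=1$ if $(v_i,v_j)$ is an arc and $0$ otherwise, and $D(\overrightarrow{G})=\mathrm{diag}(d^+(v_1),\dots,d^+(v_n))$ where $d^+$ denotes out-degree; $H(\overrightarrow{G})=\beta D(\overrightarrow{G})+\gamma A(\overrightarrow{G})$. For a vertex subset $S$, $H_S(\overrightarrow{G})$ is the principal submatrix of $H(\overrightarrow{G})$ obtained by deleting the rows and columns indexed by $S$; $H_v=H_{\{v\}}$. $\overrightarrow{G}-\overrightarrow{e}$ is obtained by deleting the arc $\overrightarrow{e}$ and keeping all vertices. A consistently directed cycle is a directed cycle all of whose arcs follow one consistent direction; $\mathcal{C}_{\overrightarrow{G}}(v)$ (resp. $\mathcal{C}_{\overrightarrow{G}}(\overrightarrow{e})$) is the set of consistently directed cycles of $\overrightarrow{G}$ containing the vertex $v$ (resp. the arc $\overrightarrow{e}$), and $|V(\overrightarrow{C})|$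 is the number of vertices of $\overrightarrow{C}$.
   Formalization: For the 0×0 matrix (a Hamiltonian cycle, or n=1) the convention d_j=0 makes the claim false (directed 2-cycle, β=0, γ=1, k=2: x²+1 against x²); here d_j of the empty matrix is (-1)^j for j≤0 and 0 for j>0; all other matrices follow the stated convention. *)

theory Defs
  imports
    "HOL-Library.Function_Algebras"
    "HOL-Combinatorics.Permutations"
    "Jordan_Normal_Form.DL_Submatrix"
    "Graph_Theory.Graph_Theory"
begin

section \<open>Characters of the symmetric group\<close>

interpretation fun_vs: Vector_Spaces.vector_space
  "\<lambda>(c::real) (f :: 'a \<Rightarrow> real) x. c * f x"
  by unfold_locales (auto simp: fun_eq_iff algebra_simps)

text \<open>The trace of a linear map \<open>T\<close> on a finite-dimensional \<open>T\<close>-invariant subspace \<open>V\<close>;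
  it does not depend on the basis that is chosen.\<close>

definition trace_on :: "('a \<Rightarrow> real) set \<Rightarrow> (('a \<Rightarrow> real) \<Rightarrow> 'a \<Rightarrow> real) \<Rightarrow> real" where
  "trace_on V T =
    (let B = (SOME B. B \<subseteq> V \<and> fun_vs.independent B \<and> V \<subseteq> fun_vs.span B)
     in \<Sum>b\<in>B. fun_vs.representation B (T b) b)"

text \<open>A partition is the list of its parts. The symmetric group \<open>S\<^sub>m\<close> acts on \<open>{0..<m}\<close>.\<close>

definition cells :: "nat list \<Rightarrow> (nat \<times> nat) set" where
  "cells lam = {(r, c). r < length lam \<and> c < lam ! r}"

definition is_tableau :: "nat list \<Rightarrow> (nat \<times> nat \<Rightarrow> nat) \<Rightarrow> bool" where
  "is_tableau lam t \<longleftrightarrow> bij_betw t (cells lam) {0..<sum_list lam}"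

text \<open>A tabloid, i.e. a class of tableaux up to row equivalence, is encoded as the list of its
  row sets. Elements of the permutation module on tabloids are real functions on such lists.\<close>

definition tabloid :: "nat list \<Rightarrow> (nat \<times> nat \<Rightarrow> nat) \<Rightarrow> nat set list" where
  "tabloid lam t = map (\<lambda>r. {t (r, c) |c. c < lam ! r}) [0..<length lam]"

definition column_stabilizer :: "nat list \<Rightarrow> (nat \<times> nat \<Rightarrow> nat) \<Rightarrow> (nat \<Rightarrow> nat) set" where
  "column_stabilizer lam t =
    {p. p permutes {0..<sum_list lam} \<and>
        (\<forall>(r, c)\<in>cells lam. \<exists>r'. (r', c) \<in> cells lam \<and> p (t (r, c)) = t (r', c))}"

definition polytabloid :: "nat list \<Rightarrow> (nat \<times> nat \<Rightarrow> nat) \<Rightarrow> nat set list \<Rightarrow> real" where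
  "polytabloid lam t =
    (\<lambda>X. \<Sum>p\<in>column_stabilizer lam t. if X = tabloid lam (p \<circ> t) then of_int (sign p) else 0)"

definition specht_module :: "nat list \<Rightarrow> (nat set list \<Rightarrow> real) set" where
  "specht_module lam = fun_vs.span {polytabloid lam t |t. is_tableau lam t}"

definition perm_act :: "(nat \<Rightarrow> nat) \<Rightarrow> (nat set list \<Rightarrow> real) \<Rightarrow> nat set list \<Rightarrow> real" where
  "perm_act s f = (\<lambda>X. f (map ((`) (inv_into UNIV s)) X))"

definition irr_char :: "nat list \<Rightarrow> (nat \<Rightarrow> nat) \<Rightarrow> real" where
  "irr_char lam s = trace_on (specht_module lam) (perm_act s)"

section \<open>Hook immanants\<close>

definition hook :: "nat \<Rightarrow> nat \<Rightarrow> nat list" where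
  "hook j m = j # replicate (m - j) 1"

text \<open>For \<open>m \<ge> 1\<close> the value is \<open>0\<close> outside \<open>1 \<le> j \<le> m\<close>. The empty matrix (\<open>m = 0\<close>) has no
  hook at all. Its value is read off from the usual straightening rule
  \<open>\<chi>(\<dots>,a,b,\<dots>) = - \<chi>(\<dots>,b-1,a+1,\<dots>)\<close> for characters indexed by integer sequences: it sends
  \<open>(j,1\<^sup>m\<^sup>-\<^sup>j)\<close> with \<open>j \<le> 0\<close> to \<open>0\<close> if \<open>m \<ge> 1\<close>, and to \<open>(-1)\<^sup>j\<close> times the character of the
  empty partition if \<open>m = 0\<close>. With the value \<open>0\<close> for the empty matrix, the expansions along a
  vertex or an arc would lose the contribution of the Hamiltonian cycles.\<close>

definition hook_immanant :: "int \<Rightarrow> real mat \<Rightarrow> real" where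
  "hook_immanant j M =
    (let m = dim_row M in
     if 1 \<le> j \<and> j \<le> int m then
       \<Sum>s | s permutes {0..<m}. irr_char (hook (nat j) m) s * (\<Prod>i = 0..<m. M $$ (i, s i))
     else if m = 0 \<and> j \<le> 0 then (-1) ^ nat (- j)
     else 0)"

definition hook_poly :: "int \<Rightarrow> real mat \<Rightarrow> real \<Rightarrow> real" where
  "hook_poly j M x = hook_immanant j (x \<cdot>\<^sub>m 1\<^sub>m (dim_row M) - M)"

section \<open>Matrices and cycles of a digraph\<close>

text \<open>The list \<open>vs\<close> enumerates the vertices.\<close>

definition adj_mat :: "('a, 'b) pre_digraph \<Rightarrow> 'a list \<Rightarrow> real mat" where
  "adj_mat G vs = mat (length vs) (length vs)
    (\<lambda>(i, j). if (vs ! i, vs ! j) \<in> arcs_ends G then 1 else 0)"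

definition out_deg_mat :: "('a, 'b) pre_digraph \<Rightarrow> 'a list \<Rightarrow> real mat" where
  "out_deg_mat G vs = mat_diag (length vs) (\<lambda>i. real (out_degree G (vs ! i)))"

definition H_mat :: "real \<Rightarrow> real \<Rightarrow> ('a, 'b) pre_digraph \<Rightarrow> 'a list \<Rightarrow> real mat" where
  "H_mat \<beta> \<gamma> G vs = \<beta> \<cdot>\<^sub>m out_deg_mat G vs + \<gamma> \<cdot>\<^sub>m adj_mat G vs"

definition H_del :: "real \<Rightarrow> real \<Rightarrow> ('a, 'b) pre_digraph \<Rightarrow> 'a list \<Rightarrow> 'a set \<Rightarrow> real mat" where
  "H_del \<beta> \<gamma> G vs S =
    (let I = {i. i < length vs \<and> vs ! i \<notin> S} in submatrix (H_mat \<beta> \<gamma> G vs) I I)"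

text \<open>Closed walks that differ by a rotation are the same cycle, so a cycle is represented by
  its set of arcs.\<close>

definition dicycles :: "('a, 'b) pre_digraph \<Rightarrow> 'b set set" where
  "dicycles G = {set p |p. pre_digraph.cycle G p}"

definition cycle_verts :: "('a, 'b) pre_digraph \<Rightarrow> 'b set \<Rightarrow> 'a set" where
  "cycle_verts G C = tail G ` C"

definition cycles_at_vertex :: "('a, 'b) pre_digraph \<Rightarrow> 'a \<Rightarrow> 'b set set" where
  "cycles_at_vertex G v = {C \<in> dicycles G. v \<in> cycle_verts G C}"

definition cycles_at_arc :: "('a, 'b) pre_digraph \<Rightarrow> 'b \<Rightarrow> 'b set set" where
  "cycles_at_arc G e = {C \<in> dicycles G. e \<in> C}"

end

theory Submission
  imports Defs "HOL-Combinatorics.Cycles"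
begin

text \<open>The Specht module of the hook \<open>(j, 1\<^sup>r)\<close> with \<open>r = m - j\<close> is the image of the boundary map
  from the exterior power \<open>\<Lambda>\<^sup>r\<^sup>+\<^sup>1\<close> to \<open>\<Lambda>\<^sup>r\<close> of the permutation module, and the complex of these
  exterior powers is exact. Hence the characters of the hooks with legs \<open>r\<close> and \<open>r + 1\<close> add up to
  the character of \<open>\<Lambda>\<^sup>r\<^sup>+\<^sup>1\<close>, and the latter counts invariant subsets with sign. Consequently,
  splitting off a cycle of length \<open>l\<close> multiplies the generating function of the hook characters
  by \<open>1 - (-q) ^ l\<close>, that is
  \<open>\<chi>\<^sub>k(c t) = \<chi>\<^sub>k\<^sub>-\<^sub>l(t) - (-1) ^ l \<chi>\<^sub>k(t)\<close>. Grouping the permutations in the immanant by their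
  cycle through \<open>v\<close> gives the expansion along a vertex. The expansion along an arc \<open>(v, u)\<close> is the
  difference of the vertex expansions at \<open>v\<close> with and without the arc.\<close>

section \<open>Traces\<close>

abbreviation (input) scale_fun :: "real \<Rightarrow> ('a \<Rightarrow> real) \<Rightarrow> 'a \<Rightarrow> real" (infixr \<open>*\<^sub>F\<close> 75) where
  "c *\<^sub>F f \<equiv> (\<lambda>x. c * f x)"

abbreviation linear_map :: "(('a \<Rightarrow> real) \<Rightarrow> 'b \<Rightarrow> real) \<Rightarrow> bool" where
  "linear_map \<equiv> Vector_Spaces.linear (*\<^sub>F) (*\<^sub>F)"

abbreviation linear_form :: "(('a \<Rightarrow> real) \<Rightarrow> real) \<Rightarrow> bool" where
  "linear_form \<equiv> Vector_Spaces.linear (*\<^sub>F) (*)"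

interpretation fun_pair: vector_space_pair
  "\<lambda>(c::real) (f :: 'a \<Rightarrow> real) x. c * f x" "\<lambda>(c::real) (f :: 'b \<Rightarrow> real) x. c * f x" ..

interpretation fun_form: vector_space_pair
  "\<lambda>(c::real) (f :: 'a \<Rightarrow> real) x. c * f x" "(*) :: real \<Rightarrow> real \<Rightarrow> real"
  by unfold_locales (auto simp: algebra_simps)

lemma linear_mapI:
  assumes "\<And>f g. T (f + g) = T f + T g" "\<And>c f. T (c *\<^sub>F f) = c *\<^sub>F T f"
  shows "linear_map T"
  using assms by (simp add: Vector_Spaces.linear_iff fun_vs.vector_space_axioms)

lemma linear_form_apply: "linear_form (\<lambda>f. f x)"
  using fun_form.vector_space_pair_axioms
  by (simp add: Vector_Spaces.linear_iff vector_space_pair_def)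

lemma sum_fun_apply: "(\<Sum>i\<in>I. f i) x = (\<Sum>i\<in>I. f i x)"
  by (induction I rule: infinite_finite_induct) auto

lemma sum_scale_apply_dual:
  assumes "finite I" "i \<in> I" "\<And>j. j \<in> I \<Longrightarrow> e j x = (if i = j then 1 else 0)"
  shows "(\<Sum>j\<in>I. c j *\<^sub>F e j) x = c i"
proof -
  have "(\<Sum>j\<in>I. c j *\<^sub>F e j) x = (\<Sum>j\<in>I. if i = j then c j else 0)"
    unfolding sum_fun_apply using assms(3) by (intro sum.cong) auto
  then show ?thesis using assms(1,2) by simp
qed

lemma linear_map_sum_scale:
  assumes "linear_map T"
  shows "T (\<Sum>i\<in>I. c i *\<^sub>F e i) = (\<Sum>i\<in>I. c i *\<^sub>F T (e i))"
  by (simp only: fun_pair.linear_sum[OF assms] fun_pair.linear_scale[OF assms])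

lemma linear_form_sum_scale:
  assumes "linear_form p"
  shows "p (\<Sum>i\<in>I. c i *\<^sub>F e i) = (\<Sum>i\<in>I. c i * p (e i))"
  by (simp only: fun_form.linear_sum[OF assms] fun_form.linear_scale[OF assms])

definition reproducing ::
  "('a \<Rightarrow> real) set \<Rightarrow> 'i set \<Rightarrow> ('i \<Rightarrow> 'a \<Rightarrow> real) \<Rightarrow> ('i \<Rightarrow> ('a \<Rightarrow> real) \<Rightarrow> real) \<Rightarrow> bool" where
  "reproducing V I e p \<longleftrightarrow> finite I \<and> (\<forall>i\<in>I. e i \<in> V \<and> linear_form (p i)) \<and>
     (\<forall>f\<in>V. f = (\<Sum>i\<in>I. p i f *\<^sub>F e i))"

lemma reproducingD:
  assumes "reproducing V I e p"
  shows "finite I" "i \<in> I \<Longrightarrow> e i \<in> V" "i \<in> I \<Longrightarrow> linear_form (p i)"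
    and "f \<in> V \<Longrightarrow> f = (\<Sum>i\<in>I. p i f *\<^sub>F e i)"
  using assms unfolding reproducing_def by blast+

lemma reproducing_subset_span:
  assumes "reproducing V I e p"
  shows "V \<subseteq> fun_vs.span (e ` I)"
proof
  fix f assume "f \<in> V"
  then have "f = (\<Sum>i\<in>I. p i f *\<^sub>F e i)" by (rule reproducingD(4)[OF assms])
  also have "\<dots> \<in> fun_vs.span (e ` I)"
    by (intro fun_vs.span_sum fun_vs.span_scale fun_vs.span_base) auto
  finally show "f \<in> fun_vs.span (e ` I)" .
qed

text \<open>The basis is extended to one of the whole space so that the coordinates are linear everywhere.\<close>

definition coordinate :: "('a \<Rightarrow> real) set \<Rightarrow> ('a \<Rightarrow> real) \<Rightarrow> ('a \<Rightarrow> real) \<Rightarrow> real" where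
  "coordinate B b f = fun_vs.representation (fun_vs.extend_basis B) f b"

lemma coordinate_eq_representation:
  assumes "fun_vs.independent B" "f \<in> fun_vs.span B"
  shows "coordinate B b f = fun_vs.representation B f b"
  unfolding coordinate_def
  by (subst fun_vs.representation_extend[OF fun_vs.independent_extend_basis[OF assms(1)] assms(2)
        fun_vs.extend_basis_superset[OF assms(1)]]) (rule refl)

lemma reproducing_coordinate:
  assumes "fun_vs.independent B" "finite B"
  shows "reproducing (fun_vs.span B) B (\<lambda>b. b) (coordinate B)"
proof -
  have "linear_form (coordinate B b)" for b
    unfolding coordinate_def
    using assms(1) fun_vs.independent_extend_basis fun_vs.span_extend_basis
    by (intro fun_vs.linear_representation) blast+
  moreover have "f = (\<Sum>b\<in>B. coordinate B b f *\<^sub>F b)" if "f \<in> fun_vs.span B" for f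
    unfolding coordinate_eq_representation[OF assms(1) that]
    by (rule fun_vs.sum_representation_eq[OF assms(1) that assms(2) order_refl, symmetric])
  ultimately show ?thesis
    unfolding reproducing_def using assms(2) by (blast intro: fun_vs.span_base)
qed

lemma ex_reproducing:
  fixes V :: "('a \<Rightarrow> real) set"
  assumes "fun_vs.subspace V" "V \<subseteq> fun_vs.span X" "finite X"
  obtains B :: "('a \<Rightarrow> real) set" and e p where "reproducing V B e p"
proof -
  obtain B where B: "B \<subseteq> V" "fun_vs.independent B" "V \<subseteq> fun_vs.span B"
    using fun_vs.maximal_independent_subset[of V] by metis
  then have "finite B" using fun_vs.independent_span_bound[of X B] assms(2,3) by blast
  moreover have "fun_vs.span B = V" using B assms(1) fun_vs.span_minimal by blast
  ultimately show ?thesis using reproducing_coordinate[OF B(2)] by (intro that) simp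
qed

text \<open>Neither system has to be linearly independent: expand \<open>T (e i)\<close> in the second one and
  exchange the two sums.\<close>

lemma reproducing_trace_eq:
  assumes "linear_map T" "T ` V \<subseteq> V"
    and p: "reproducing V I e p" and q: "reproducing V J e' q"
  shows "(\<Sum>i\<in>I. p i (T (e i))) = (\<Sum>j\<in>J. q j (T (e' j)))"
proof -
  have "p i (T (e i)) = (\<Sum>j\<in>J. q j (T (e i)) * p i (e' j))" if "i \<in> I" for i
  proof -
    have "T (e i) \<in> V" using assms(2) reproducingD(2)[OF p that] by blast
    from reproducingD(4)[OF q this] show ?thesis
      using linear_form_sum_scale[OF reproducingD(3)[OF p that]] by metis
  qed
  moreover have "q j (T (e' j)) = (\<Sum>i\<in>I. q j (T (e i)) * p i (e' j))" if "j \<in> J" for j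
  proof -
    have "T (e' j) = (\<Sum>i\<in>I. p i (e' j) *\<^sub>F T (e i))"
      using linear_map_sum_scale[OF assms(1)] reproducingD(4)[OF p reproducingD(2)[OF q that]]
      by metis
    then have "q j (T (e' j)) = (\<Sum>i\<in>I. p i (e' j) * q j (T (e i)))"
      using linear_form_sum_scale[OF reproducingD(3)[OF q that]] by metis
    then show ?thesis by (simp add: mult.commute)
  qed
  ultimately show ?thesis by (simp add: sum.swap[of _ J I])
qed

lemma trace_on_eq_sum:
  assumes V: "fun_vs.subspace V" and T: "linear_map T" "T ` V \<subseteq> V"
    and e: "reproducing V I e p"
  shows "trace_on V T = (\<Sum>i\<in>I. p i (T (e i)))"
proof -
  define basis where "basis B \<longleftrightarrow> B \<subseteq> V \<and> fun_vs.independent B \<and> V \<subseteq> fun_vs.span B" for B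
  define B where "B = (SOME B. basis B)"
  have "\<exists>B. basis B" unfolding basis_def using fun_vs.maximal_independent_subset[of V] by metis
  then have "basis B" unfolding B_def by (rule someI_ex)
  then have B: "B \<subseteq> V" "fun_vs.independent B" "V \<subseteq> fun_vs.span B"
    unfolding basis_def by blast+
  then have span: "fun_vs.span B = V" using V fun_vs.span_minimal by blast
  have "finite B"
    using fun_vs.independent_span_bound[of "e ` I" B] B reproducingD(1)[OF e]
      reproducing_subset_span[OF e] by blast
  note B_system = reproducing_coordinate[OF B(2) this, unfolded span]
  have "trace_on V T = (\<Sum>b\<in>B. fun_vs.representation B (T b) b)"
    unfolding trace_on_def Let_def B_def basis_def ..
  also have "\<dots> = (\<Sum>b\<in>B. coordinate B b (T b))"
  proof (rule sum.cong[OF refl])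
    fix b assume "b \<in> B"
    then have "T b \<in> fun_vs.span B" using B(1) T(2) span by blast
    then show "fun_vs.representation B (T b) b = coordinate B b (T b)"
      by (rule coordinate_eq_representation[OF B(2), symmetric])
  qed
  also have "\<dots> = (\<Sum>i\<in>I. p i (T (e i)))"
    by (rule reproducing_trace_eq[OF T B_system e])
  finally show ?thesis .
qed

lemma reproducing_kernel_image:
  assumes V: "fun_vs.subspace V" and F: "linear_map F"
    and S: "range S \<subseteq> V" "linear_map S" "\<And>g. g \<in> F ` V \<Longrightarrow> F (S g) = g"
    and e: "reproducing {f \<in> V. F f = 0} I e p" and e': "reproducing (F ` V) J e' q"
  shows "reproducing V (I <+> J) (case_sum e (\<lambda>j. S (e' j)))
    (case_sum (\<lambda>i f. p i (f - S (F f))) (\<lambda>j f. q j (F f)))"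
    (is "reproducing V _ ?e ?p")
  unfolding reproducing_def
proof (intro conjI ballI)
  show "finite (I <+> J)" using reproducingD(1)[OF e] reproducingD(1)[OF e'] by simp
  show "?e i \<in> V" if "i \<in> I <+> J" for i
    using that reproducingD(2)[OF e] S(1) by auto
  have SF: "linear_map (\<lambda>f. S (F f))"
    using Vector_Spaces.linear_compose[OF F S(2)] by (simp add: o_def)
  have "linear_form (\<lambda>f. p i (f - S (F f)))" if "i \<in> I" for i
    using Vector_Spaces.linear_compose[OF fun_pair.linear_compose_sub[OF fun_vs.linear_ident SF]
        reproducingD(3)[OF e that]] by (simp add: o_def)
  moreover have "linear_form (\<lambda>f. q j (F f))" if "j \<in> J" for j
    using Vector_Spaces.linear_compose[OF F reproducingD(3)[OF e' that]] by (simp add: o_def)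
  ultimately show "linear_form (?p i)" if "i \<in> I <+> J" for i using that by auto
  fix f assume f: "f \<in> V"
  have "F (f - S (F f)) = 0" using f by (simp add: fun_pair.linear_diff[OF F] S(3))
  moreover have "f - S (F f) \<in> V" using f S(1) by (intro fun_vs.subspace_diff[OF V]) auto
  ultimately have ker: "f - S (F f) = (\<Sum>i\<in>I. p i (f - S (F f)) *\<^sub>F e i)"
    by (intro reproducingD(4)[OF e]) blast
  have "F f = (\<Sum>j\<in>J. q j (F f) *\<^sub>F e' j)" using f by (intro reproducingD(4)[OF e']) blast
  then have "S (F f) = (\<Sum>j\<in>J. q j (F f) *\<^sub>F S (e' j))"
    using linear_map_sum_scale[OF S(2), of "\<lambda>j. q j (F f)" e' J] by simp
  with ker have "f - S (F f) + S (F f)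
      = (\<Sum>i\<in>I. p i (f - S (F f)) *\<^sub>F e i) + (\<Sum>j\<in>J. q j (F f) *\<^sub>F S (e' j))"
    by (rule arg_cong2)
  then show "f = (\<Sum>i\<in>I <+> J. ?p i f *\<^sub>F ?e i)"
    unfolding sum.Plus[OF reproducingD(1)[OF e] reproducingD(1)[OF e']] o_def sum.case
      diff_add_cancel .
qed

lemma trace_on_kernel_image:
  assumes V: "fun_vs.subspace V" "V \<subseteq> fun_vs.span X" "finite X"
    and F: "linear_map F" and T: "linear_map T" "T ` V \<subseteq> V" and T': "linear_map T'"
    and comm: "\<And>f. f \<in> V \<Longrightarrow> F (T f) = T' (F f)"
  shows "trace_on V T = trace_on {f \<in> V. F f = 0} T + trace_on (F ` V) T'"
proof -
  let ?K = "{f \<in> V. F f = 0}"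
  have K: "fun_vs.subspace ?K" "T ` ?K \<subseteq> ?K"
    using fun_vs.subspace_inter[OF V(1) fun_pair.linear_subspace_kernel[OF F]]
      T(2) comm fun_pair.linear_0[OF T'] by (auto simp: Int_def)
  have "T' ` F ` V = F ` T ` V" by (simp add: image_image comm cong: image_cong)
  then have W: "fun_vs.subspace (F ` V)" "T' ` F ` V \<subseteq> F ` V"
    using fun_pair.linear_subspace_image[OF F V(1)] T(2) by (simp_all add: image_mono)
  obtain I :: "('a \<Rightarrow> real) set" and e p where e: "reproducing ?K I e p"
    using ex_reproducing[OF K(1) _ V(3)] V(2) by blast
  have "F ` V \<subseteq> fun_vs.span (F ` X)" using V(2) fun_pair.linear_span_image[OF F] by blast
  then obtain J :: "('b \<Rightarrow> real) set" and e' q where e': "reproducing (F ` V) J e' q"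
    using ex_reproducing[OF W(1)] V(3) by blast
  obtain S where S: "range S \<subseteq> V" "linear_map S" "\<And>g. g \<in> F ` V \<Longrightarrow> F (S g) = g"
    using fun_pair.linear_exists_right_inverse_on[OF F V(1)] by blast
  have ker: "p i (T (e i) - S (F (T (e i)))) = p i (T (e i))" if "i \<in> I" for i
  proof -
    have "F (T (e i)) = 0" using reproducingD(2)[OF e that] K(2) by blast
    then show ?thesis by (simp add: fun_pair.linear_0[OF S(2)])
  qed
  have im: "q j (F (T (S (e' j)))) = q j (T' (e' j))" if "j \<in> J" for j
  proof -
    have "F (T (S (e' j))) = T' (F (S (e' j)))" using S(1) by (intro comm) auto
    then show ?thesis using S(3)[OF reproducingD(2)[OF e' that]] by simp
  qed
  have "trace_on V T = (\<Sum>i\<in>I. p i (T (e i) - S (F (T (e i))))) + (\<Sum>j\<in>J. q j (F (T (S (e' j)))))"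
    using trace_on_eq_sum[OF V(1) T reproducing_kernel_image[OF V(1) F S e e']]
    by (simp add: sum.Plus[OF reproducingD(1)[OF e] reproducingD(1)[OF e']] o_def)
  also have "\<dots> = trace_on ?K T + trace_on (F ` V) T'"
    unfolding trace_on_eq_sum[OF K(1) T(1) K(2) e] trace_on_eq_sum[OF W(1) T' W(2) e']
    by (simp add: ker im)
  finally show ?thesis .
qed

lemma trace_on_inj_image:
  assumes V: "fun_vs.subspace V" "V \<subseteq> fun_vs.span X" "finite X"
    and F: "linear_map F" "inj F" and T: "linear_map T" "T ` V \<subseteq> V" and T': "linear_map T'"
    and comm: "\<And>f. f \<in> V \<Longrightarrow> F (T f) = T' (F f)"
  shows "trace_on (F ` V) T' = trace_on V T"
proof -
  have "f = 0" if "F f = 0" for f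
    using that fun_pair.linear_0[OF F(1)] injD[OF F(2), of f 0] by simp
  then have "{f \<in> V. F f = 0} = {0}"
    using fun_vs.subspace_0[OF V(1)] fun_pair.linear_0[OF F(1)] by auto
  moreover have "reproducing {0} {} undefined undefined" by (simp add: reproducing_def)
  then have "trace_on {0} T = 0"
    using fun_pair.linear_0[OF T(1)]
    by (subst trace_on_eq_sum[OF fun_vs.subspace_single_0 T(1)]) auto
  ultimately show ?thesis using trace_on_kernel_image[OF V F(1) T T' comm] by simp
qed

section \<open>Cycles of permutations\<close>

lemma perm_restrict_permutes:
  assumes "s permutes S" "s ` A = A"
  shows "perm_restrict s A permutes A"
proof (rule bij_imp_permutes)
  have "inj_on s A" using assms(1) permutes_inj inj_on_subset by blast
  then show "bij_betw (perm_restrict s A) A A"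
    using assms(2) by (simp add: bij_betw_def perm_restrict_def inj_on_def)
qed (simp add: perm_restrict_def)

lemma comp_permutes_disjoint:
  assumes "c permutes C" "t permutes T" "C \<inter> T = {}"
  shows "x \<in> C \<Longrightarrow> (c \<circ> t) x = c x" "x \<notin> C \<Longrightarrow> (c \<circ> t) x = t x"
proof -
  show "(c \<circ> t) x = c x" if "x \<in> C"
  proof -
    have "t x = x" using that assms(3) by (intro permutes_not_in[OF assms(2)]) blast
    then show ?thesis by simp
  qed
  assume "x \<notin> C"
  then have "t x \<notin> C"
    using assms(3) permutes_in_image[OF assms(2), of x] permutes_not_in[OF assms(2), of x] by auto
  then show "(c \<circ> t) x = t x" using permutes_not_in[OF assms(1)] by simp
qed

lemma perm_restrict_comp_disjoint:
  assumes "c permutes C" "t permutes T" "C \<inter> T = {}" "A \<subseteq> T"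
  shows "perm_restrict (c \<circ> t) A = perm_restrict t A"
    and "perm_restrict (c \<circ> t) (C \<union> A) = c \<circ> perm_restrict t A"
proof -
  note ct = comp_permutes_disjoint[OF assms(1-3)]
  show "perm_restrict (c \<circ> t) A = perm_restrict t A"
  proof
    fix x show "perm_restrict (c \<circ> t) A x = perm_restrict t A x"
      using ct(2)[of x] assms(3,4) by (cases "x \<in> A") (auto simp: perm_restrict_simps)
  qed
  show "perm_restrict (c \<circ> t) (C \<union> A) = c \<circ> perm_restrict t A"
  proof
    fix x
    consider "x \<in> C" "x \<notin> A" | "x \<in> A" | "x \<notin> A" "x \<notin> C" using assms(3,4) by blast
    then show "perm_restrict (c \<circ> t) (C \<union> A) x = (c \<circ> perm_restrict t A) x"
      using ct(1)[of x] permutes_not_in[OF assms(1), of x]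
      by cases (simp_all add: perm_restrict_simps)
  qed
qed

lemma perm_restrict_orbit_decomposition:
  assumes "finite S" "s permutes S" "v \<in> S"
  shows "v \<in> orbit s v" "orbit s v \<subseteq> S" "cyclic_on (perm_restrict s (orbit s v)) (orbit s v)"
    "perm_restrict s (orbit s v) permutes orbit s v"
    "perm_restrict s (S - orbit s v) permutes (S - orbit s v)"
    "perm_restrict s (orbit s v) \<circ> perm_restrict s (S - orbit s v) = s"
proof -
  let ?C = "orbit s v"
  have cyc: "cyclic_on s ?C" by (rule cyclic_on_orbit[OF assms(2,1)])
  then show "cyclic_on (perm_restrict s ?C) ?C" by (simp add: cyclic_on_perm_restrict)
  have "permutation s" using assms(1,2) permutation_permutes by blast
  then show "v \<in> ?C" by (rule permutation_self_in_orbit)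
  show sub: "?C \<subseteq> S" by (rule permutes_orbit_subset[OF assms(2,3)])
  have "s ` ?C = ?C"
    using endo_inj_surj[of ?C s] finite_subset[OF sub assms(1)] cyclic_on_inI[OF cyc]
      inj_on_subset[OF permutes_inj[OF assms(2)]] by blast
  then show C: "perm_restrict s ?C permutes ?C" by (rule perm_restrict_permutes[OF assms(2)])
  show D: "perm_restrict s (S - ?C) permutes (S - ?C)"
    by (rule perm_restrict_diff_cyclic[OF assms(2) cyc])
  have "perm_restrict s ?C \<circ> perm_restrict s (S - ?C) = perm_restrict s (?C \<union> (S - ?C))"
    by (rule perm_restrict_union[OF C D]) blast
  also have "?C \<union> (S - ?C) = S" using sub by blast
  finally show "perm_restrict s ?C \<circ> perm_restrict s (S - ?C) = s"
    unfolding perm_restrict_id[OF assms(2)] .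
qed

lemma image_comp_disjoint:
  assumes "c permutes C" "t permutes T" "C \<inter> T = {}" "A \<subseteq> T"
  shows "(c \<circ> t) ` A = t ` A" "(c \<circ> t) ` (C \<union> A) = C \<union> t ` A"
proof -
  note ct = comp_permutes_disjoint[OF assms(1-3)]
  show A: "(c \<circ> t) ` A = t ` A"
    using assms(3,4) by (intro image_cong refl ct(2)) blast
  have "(c \<circ> t) ` C = c ` C" using ct(1) by (rule image_cong[OF refl])
  then show "(c \<circ> t) ` (C \<union> A) = C \<union> t ` A"
    unfolding image_Un A permutes_image[OF assms(1)] by simp
qed

lemma sign_cycle_of_list:
  assumes "distinct cs" "cs \<noteq> []"
  shows "sign (cycle_of_list cs) = - ((-1) ^ length cs)"
  using assms
proof (induction cs rule: cycle_of_list.induct)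
  case (1 i j cs)
  then show ?case
    by (simp add: sign_compose permutation_of_cycle permutation_swap_id sign_swap_id
        del: comp_apply o_apply)
qed (auto simp: sign_id)

lemma orbit_cycle_of_list:
  assumes "distinct cs" "v \<in> set cs"
  shows "orbit (cycle_of_list cs) v = set cs"
proof -
  let ?c = "cycle_of_list cs"
  have ne: "0 < length cs" using assms(2) by (cases cs) auto
  have "set cs = orbit ?c (cs ! 0)"
  proof
    show "orbit ?c (cs ! 0) \<subseteq> set cs"
      using ne by (intro permutes_orbit_subset[OF cycle_permutes]) simp
    show "set cs \<subseteq> orbit ?c (cs ! 0)"
    proof
      fix y assume "y \<in> set cs"
      then obtain n where n: "n < length cs" "y = cs ! n" by (auto simp: in_set_conv_nth)
      have "(?c ^^ n) (cs ! 0) = map (?c ^^ n) cs ! 0" using ne by simp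
      also have "\<dots> = rotate n cs ! 0" unfolding cyclic_rotation[OF assms(1)] ..
      also have "\<dots> = y" using n ne by (simp add: nth_rotate)
      finally show "y \<in> orbit ?c (cs ! 0)"
        unfolding orbit_altdef_permutation[OF permutation_of_cycle] by blast
    qed
  qed
  then have "cyclic_on ?c (set cs)" unfolding cyclic_on_def using ne nth_mem by blast
  then show ?thesis using assms(2) by (rule orbit_cyclic_eq3)
qed

lemma ex_cycle_of_list:
  assumes "c permutes C" "finite C" "cyclic_on c C"
  obtains cs where "distinct cs" "set cs = C" "c = cycle_of_list cs"
proof -
  have perm: "permutation c" using assms permutation_permutes by blast
  obtain v where v: "C = orbit c v" using assms(3) unfolding cyclic_on_def by blast
  have set: "set (support c v) = C"
    using support_set[OF perm, of v] orbit_altdef_permutation[OF perm, of v] v by auto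
  have "c y = cycle_of_list (support c v) y" for y
    using cycle_restrict[OF perm, of y v] id_outside_supp[of y "support c v"]
      permutes_not_in[OF assms(1), of y] set by (cases "y \<in> C") auto
  then show ?thesis using that[OF cycle_of_permutation[OF perm] set] by blast
qed

lemma sign_cyclic_on:
  assumes "c permutes C" "finite C" "cyclic_on c C"
  shows "sign c = - ((-1) ^ card C)"
proof -
  obtain cs where cs: "distinct cs" "set cs = C" "c = cycle_of_list cs"
    using ex_cycle_of_list[OF assms] .
  then have "cs \<noteq> []" using assms(3) unfolding cyclic_on_def by auto
  then show ?thesis using sign_cycle_of_list[OF cs(1)] distinct_card[OF cs(1)] cs(2,3) by simp
qed

lemma cyclic_on_subset_invariant:
  assumes "cyclic_on s C" "s ` A = A" "A \<inter> C \<noteq> {}"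
  shows "C \<subseteq> A"
proof -
  obtain x where x: "x \<in> A" "x \<in> C" using assms(3) by blast
  have "y \<in> A" if "y \<in> orbit s x" for y
    using that by induction (use x(1) assms(2) in blast)+
  then show ?thesis using orbit_cyclic_eq3[OF assms(1) x(2)] by blast
qed

section \<open>Hook characters of permutations\<close>

definition invariant_sets :: "'a set \<Rightarrow> ('a \<Rightarrow> 'a) \<Rightarrow> 'a set set" where
  "invariant_sets S s = {A. A \<subseteq> S \<and> s ` A = A}"

lemma finite_invariant_sets: "finite S \<Longrightarrow> finite (invariant_sets S s)"
  unfolding invariant_sets_def by simp

lemma invariant_sets_cyclic_comp:
  assumes C: "C \<subseteq> S" "c permutes C" "cyclic_on c C" and t: "t permutes (S - C)"
  shows "invariant_sets S (c \<circ> t) = invariant_sets (S - C) t \<union> (\<union>) C ` invariant_sets (S - C) t"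
    (is "_ = ?F \<union> _")
proof -
  note im = image_comp_disjoint[OF C(2) t Diff_disjoint]
  have cyc: "cyclic_on (c \<circ> t) C"
    by (rule permutes_comp_preserves_cyclic1[OF t C(3) Diff_disjoint order_refl])
  show ?thesis
  proof (intro equalityI subsetI)
    fix A assume "A \<in> invariant_sets S (c \<circ> t)"
    then have A: "A \<subseteq> S" "(c \<circ> t) ` A = A" unfolding invariant_sets_def by auto
    show "A \<in> ?F \<union> (\<union>) C ` ?F"
    proof (cases "A \<inter> C = {}")
      case True
      then have "A \<subseteq> S - C" using A(1) by blast
      then show ?thesis using A(2) im(1)[of A] unfolding invariant_sets_def by simp
    next
      case False
      have CA: "C \<subseteq> A" by (rule cyclic_on_subset_invariant[OF cyc A(2) False])
      define B where "B = A - C"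
      have B: "A = C \<union> B" "B \<subseteq> S - C" using CA A(1) by (auto simp: B_def)
      have "C \<union> t ` B = C \<union> B" using A(2) im(2)[OF B(2)] B(1) by simp
      moreover have "t ` B \<subseteq> S - C" using image_mono[OF B(2)] permutes_image[OF t] by metis
      ultimately have "t ` B = B" using B(2) by blast
      then show ?thesis using B unfolding invariant_sets_def by blast
    qed
  next
    fix A assume "A \<in> ?F \<union> (\<union>) C ` ?F"
    then obtain B where B: "B \<subseteq> S - C" "t ` B = B" "A = B \<or> A = C \<union> B"
      unfolding invariant_sets_def by blast
    from B(3) show "A \<in> invariant_sets S (c \<circ> t)"
      using im[OF B(1)] B(1,2) C(1) unfolding invariant_sets_def by auto
  qed
qed

lemma sum_invariant_sets_cyclic_comp:
  fixes g :: "'a set \<Rightarrow> 'b::comm_monoid_add"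
  assumes "finite S" and C: "C \<subseteq> S" "c permutes C" "cyclic_on c C" and t: "t permutes (S - C)"
  shows "(\<Sum>A\<in>invariant_sets S (c \<circ> t). g A)
    = (\<Sum>A\<in>invariant_sets (S - C) t. g A) + (\<Sum>A\<in>invariant_sets (S - C) t. g (C \<union> A))"
proof -
  let ?F = "invariant_sets (S - C) t"
  have "C \<noteq> {}" using C(3) unfolding cyclic_on_def by blast
  then have "?F \<inter> (\<union>) C ` ?F = {}" unfolding invariant_sets_def by blast
  moreover have "inj_on ((\<union>) C) ?F" unfolding invariant_sets_def by (auto simp: inj_on_def)
  ultimately show ?thesis
    unfolding invariant_sets_cyclic_comp[OF C t]
    using assms(1) by (simp add: sum.union_disjoint finite_invariant_sets sum.reindex)
qed

text \<open>The coefficient of \<open>q\<^sup>n\<close> in \<open>1 / (1 + q)\<close>.\<close>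

definition geometric_coeff :: "int \<Rightarrow> real" where
  "geometric_coeff n = (if n < 0 then 0 else (-1) ^ nat n)"

lemma geometric_coeff_plus_1:
  "geometric_coeff (n + 1) + geometric_coeff n = (if n = - 1 then 1 else 0)"
  by (auto simp: geometric_coeff_def nat_add_distrib)

lemma geometric_coeff_add:
  assumes "0 \<le> n"
  shows "geometric_coeff (n + int m) = (-1) ^ m * geometric_coeff n"
  using assms by (simp add: geometric_coeff_def nat_add_distrib power_add)

definition hook_weight :: "'a set \<Rightarrow> ('a \<Rightarrow> 'a) \<Rightarrow> int \<Rightarrow> 'a set \<Rightarrow> real" where
  "hook_weight S s k A
    = geometric_coeff (int (card (S - A)) - k) * of_int (sign (perm_restrict s A))"

text \<open>If \<open>s\<close> has cycle lengths \<open>l\<^sub>1, l\<^sub>2, \<dots>\<close> on \<open>S\<close>, then \<open>hook_char S s k\<close> is the coefficient of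
  \<open>q ^ (card S - k)\<close> in \<open>(\<Prod>i. 1 - (-q) ^ l\<^sub>i) / (1 + q)\<close>; the sum over the invariant sets \<open>A\<close>
  comes from multiplying out the product. Unlike the character it makes sense for every integer
  \<open>k\<close> and for empty \<open>S\<close>, so that the recursion over the cycles needs no case distinctions.\<close>

definition hook_char :: "'a set \<Rightarrow> ('a \<Rightarrow> 'a) \<Rightarrow> int \<Rightarrow> real" where
  "hook_char S s k = (\<Sum>A\<in>invariant_sets S s. hook_weight S s k A)"

lemma hook_weight_comp_disjoint:
  assumes "finite S" and C: "C \<subseteq> S" "c permutes C" and t: "t permutes (S - C)"
    and A: "A \<subseteq> S - C"
  shows "hook_weight S (c \<circ> t) k A = hook_weight (S - C) t (k - int (card C)) A"
proof -
  have "S - A = C \<union> (S - C - A)" using A C(1) by auto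
  moreover have "card (C \<union> (S - C - A)) = card C + card (S - C - A)"
    using assms(1) finite_subset[OF C(1)] by (intro card_Un_disjoint) auto
  ultimately show ?thesis
    unfolding hook_weight_def perm_restrict_comp_disjoint(1)[OF C(2) t Diff_disjoint A]
    by (simp add: algebra_simps)
qed

lemma hook_weight_cyclic_comp_Un:
  assumes "finite S" and C: "C \<subseteq> S" "c permutes C" "cyclic_on c C" and t: "t permutes (S - C)"
    and A: "A \<in> invariant_sets (S - C) t"
  shows "hook_weight S (c \<circ> t) k (C \<union> A) = - ((-1) ^ card C) * hook_weight (S - C) t k A"
proof -
  have A: "A \<subseteq> S - C" "t ` A = A" using A unfolding invariant_sets_def by auto
  have fin: "finite C" "finite A" using assms(1) C(1) A(1) finite_subset by blast+
  have "perm_restrict t A permutes A" by (rule perm_restrict_permutes[OF t A(2)])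
  then have "sign (c \<circ> perm_restrict t A) = sign c * sign (perm_restrict t A)"
    using C(2) fin permutation_permutes sign_compose by blast
  moreover have "S - (C \<union> A) = S - C - A" by auto
  ultimately show ?thesis
    by (simp add: hook_weight_def perm_restrict_comp_disjoint(2)[OF C(2) t Diff_disjoint A(1)]
        sign_cyclic_on[OF C(2) fin(1) C(3)])
qed

lemma hook_char_cyclic_comp:
  assumes "finite S" and C: "C \<subseteq> S" "c permutes C" "cyclic_on c C" and t: "t permutes (S - C)"
  shows "hook_char S (c \<circ> t) k
    = hook_char (S - C) t (k - int (card C)) - (-1) ^ card C * hook_char (S - C) t k"
proof -
  let ?F = "invariant_sets (S - C) t"
  have "hook_char S (c \<circ> t) k
      = (\<Sum>A\<in>?F. hook_weight S (c \<circ> t) k A) + (\<Sum>A\<in>?F. hook_weight S (c \<circ> t) k (C \<union> A))"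
    unfolding hook_char_def by (rule sum_invariant_sets_cyclic_comp[OF assms])
  also have "(\<Sum>A\<in>?F. hook_weight S (c \<circ> t) k A) = hook_char (S - C) t (k - int (card C))"
    unfolding hook_char_def
    by (intro sum.cong refl hook_weight_comp_disjoint[OF assms(1) C(1,2) t])
      (simp add: invariant_sets_def)
  also have "(\<Sum>A\<in>?F. hook_weight S (c \<circ> t) k (C \<union> A)) = - ((-1) ^ card C) * hook_char (S - C) t k"
    unfolding hook_char_def sum_distrib_left
    by (intro sum.cong refl hook_weight_cyclic_comp_Un[OF assms])
  finally show ?thesis by (simp only: mult_minus_left add_uminus_conv_diff)
qed

lemma hook_char_nonpos:
  assumes "finite S" "s permutes S" "S \<noteq> {}" "k \<le> 0"
  shows "hook_char S s k = 0"
proof -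
  obtain v where v: "v \<in> S" using assms(3) by blast
  let ?C = "orbit s v" and ?t = "perm_restrict s (S - orbit s v)"
  note s = perm_restrict_orbit_decomposition[OF assms(1,2) v]
  have "geometric_coeff (int n - (k - int (card ?C)))
      = (-1) ^ card ?C * geometric_coeff (int n - k)" for n
    using geometric_coeff_add[of "int n - k" "card ?C"] assms(4)
    by (simp add: algebra_simps)
  then have "hook_char (S - ?C) ?t (k - int (card ?C)) = (-1) ^ card ?C * hook_char (S - ?C) ?t k"
    unfolding hook_char_def hook_weight_def by (simp only: sum_distrib_left mult.assoc)
  then show ?thesis using hook_char_cyclic_comp[OF assms(1) s(2,4,3,5), of k]
    by (simp only: s(6) diff_self)
qed

lemma hook_char_greater:
  assumes "finite S" "k > int (card S)"
  shows "hook_char S s k = 0"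
proof -
  have "card (S - A) \<le> card S" for A using assms(1) by (simp add: card_mono)
  then have "geometric_coeff (int (card (S - A)) - k) = 0" for A
    using assms(2) unfolding geometric_coeff_def by (smt (verit) of_nat_mono)
  then show ?thesis unfolding hook_char_def hook_weight_def by simp
qed

section \<open>Alternating functions\<close>

lemma ex_permutes_map:
  assumes "distinct xs" "distinct ys" "set xs = set ys"
  obtains q where "q permutes set xs" "map q xs = ys"
proof -
  have len: "length xs = length ys"
    using distinct_card[OF assms(1)] distinct_card[OF assms(2)] assms(3) by simp
  define q where "q = (\<lambda>x. if x \<in> set xs then the (map_of (zip xs ys) x) else x)"
  have "q (xs ! i) = ys ! i" if "i < length xs" for i
    using map_of_zip_nth[OF len assms(1)] that len by (simp add: q_def)
  then have map_q: "map q xs = ys" using len by (intro nth_equalityI) simp_all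
  then have img: "q ` set xs = set xs" using assms(3) by (metis image_set)
  then have "inj_on q (set xs)" by (simp add: eq_card_imp_inj_on)
  then have "q permutes set xs"
    by (intro bij_imp_permutes) (auto simp: bij_betw_def img, simp add: q_def)
  with map_q show ?thesis using that by blast
qed

definition alternating :: "'a set \<Rightarrow> nat \<Rightarrow> ('a list \<Rightarrow> real) set" where
  "alternating U r = {f. (\<forall>ys. f ys \<noteq> 0 \<longrightarrow> distinct ys \<and> length ys = r \<and> set ys \<subseteq> U) \<and>
     (\<forall>ys q. q permutes set ys \<longrightarrow> f (map q ys) = of_int (sign q) * f ys)}"

lemma alternatingI:
  assumes "\<And>ys. f ys \<noteq> 0 \<Longrightarrow> distinct ys \<and> length ys = r \<and> set ys \<subseteq> U"
    and "\<And>ys q. q permutes set ys \<Longrightarrow> f (map q ys) = of_int (sign q) * f ys"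
  shows "f \<in> alternating U r"
  using assms unfolding alternating_def by blast

lemma alternatingD:
  assumes "f \<in> alternating U r"
  shows "f ys \<noteq> 0 \<Longrightarrow> distinct ys" "f ys \<noteq> 0 \<Longrightarrow> length ys = r" "f ys \<noteq> 0 \<Longrightarrow> set ys \<subseteq> U"
    and "q permutes set ys \<Longrightarrow> f (map q ys) = of_int (sign q) * f ys"
  using assms unfolding alternating_def by blast+

lemma subspace_alternating: "fun_vs.subspace (alternating U r)"
proof (rule fun_vs.subspaceI)
  fix f g assume f: "f \<in> alternating U r" and g: "g \<in> alternating U r"
  show "f + g \<in> alternating U r"
  proof (rule alternatingI)
    fix ys assume "(f + g) ys \<noteq> 0"
    then have "f ys \<noteq> 0 \<or> g ys \<noteq> 0" by auto
    then show "distinct ys \<and> length ys = r \<and> set ys \<subseteq> U"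
      using alternatingD(1-3)[OF f] alternatingD(1-3)[OF g] by blast
  qed (simp add: alternatingD(4)[OF f] alternatingD(4)[OF g] distrib_left)
qed (auto simp: alternating_def)

lemma alternating_eq_0_cong:
  assumes "f \<in> alternating U r" "f xs = 0" "distinct xs" "set xs = set ys"
  shows "f ys = 0"
proof (cases "distinct ys")
  case True
  obtain q where "q permutes set xs" "map q xs = ys"
    using ex_permutes_map[OF assms(3) True assms(4)] .
  then show ?thesis using alternatingD(4)[OF assms(1)] assms(2) by auto
next
  case False
  then show ?thesis using alternatingD(1)[OF assms(1)] by blast
qed

lemma alternating_swap:
  assumes "f \<in> alternating U r"
  shows "f (a # b # ys) = - f (b # a # ys)"
proof (cases "distinct (a # b # ys)")
  case True
  let ?t = "Transposition.transpose a b"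
  have "?t permutes set (b # a # ys)" by (rule permutes_swap_id) auto
  moreover have "map ?t (b # a # ys) = a # b # ys"
    using True by (auto intro: map_idI simp: transpose_eq_iff)
  moreover have "sign ?t = - 1" using True by (simp add: sign_swap_id)
  ultimately show ?thesis using alternatingD(4)[OF assms, of ?t "b # a # ys"] by simp
next
  case False
  then have "\<not> distinct (b # a # ys)" by auto
  then have "f (a # b # ys) = 0" "f (b # a # ys) = 0"
    using False alternatingD(1)[OF assms] by blast+
  then show ?thesis by simp
qed

text \<open>If \<open>xs\<close> enumerates \<open>X\<close>, the value at \<open>ys\<close> is the coefficient of \<open>ys\<close> in the wedge product of
  \<open>xs\<close>; if \<open>xs\<close> misses a single element \<open>z\<close> of \<open>X\<close>, it is the coefficient in the boundary of the
  wedge product of \<open>z # xs\<close>.\<close>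

definition antisymmetrization :: "'a set \<Rightarrow> 'a list \<Rightarrow> 'a list \<Rightarrow> real" where
  "antisymmetrization X xs ys
    = (\<Sum>p | p permutes X. if map p xs = ys then of_int (sign p) else 0)"

lemma antisymmetrization_nonzeroE:
  assumes "antisymmetrization X xs ys \<noteq> 0"
  obtains p where "p permutes X" "map p xs = ys"
proof -
  obtain p where "p permutes X" "(if map p xs = ys then of_int (sign p) else (0::real)) \<noteq> 0"
    using sum.not_neutral_contains_not_neutral[OF assms[unfolded antisymmetrization_def]] by blast
  then show ?thesis using that by (metis (full_types))
qed

lemma antisymmetrization_map:
  assumes "finite X" "q permutes X"
  shows "antisymmetrization X xs (map q ys) = of_int (sign q) * antisymmetrization X xs ys"
proof -
  have "map (q \<circ> p) xs = map q ys \<longleftrightarrow> map p xs = ys" for p :: "'a \<Rightarrow> 'a"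
    using permutes_inj[OF assms(2)] by (metis inj_map_eq_map map_map)
  moreover have "sign (q \<circ> p) = sign q * sign p" if "p permutes X" for p
    using that assms permutation_permutes sign_compose by blast
  ultimately show ?thesis
    unfolding antisymmetrization_def sum_distrib_left
    by (subst setum_permutations_compose_left[OF assms(2)]) (auto intro!: sum.cong)
qed

lemma antisymmetrization_alternating:
  assumes "finite X" "X \<subseteq> U" "distinct xs" "set xs \<subseteq> X"
  shows "antisymmetrization X xs \<in> alternating U (length xs)"
proof (rule alternatingI)
  have range: "distinct ys \<and> length ys = length xs \<and> set ys \<subseteq> X"
    if nz: "antisymmetrization X xs ys \<noteq> 0" for ys
  proof -
    obtain p where p: "p permutes X" "map p xs = ys"
      using nz by (rule antisymmetrization_nonzeroE)
    have "inj_on p (set xs)" using permutes_inj[OF p(1)] inj_on_subset by blast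
    moreover have "p ` set xs \<subseteq> X" using image_mono[OF assms(4)] permutes_image[OF p(1)] by metis
    ultimately show ?thesis using p(2) assms(3) by (auto simp: distinct_map)
  qed
  then show "distinct ys \<and> length ys = length xs \<and> set ys \<subseteq> U"
    if "antisymmetrization X xs ys \<noteq> 0" for ys using that assms(2) by blast
  show "antisymmetrization X xs (map q ys) = of_int (sign q) * antisymmetrization X xs ys"
    if q: "q permutes set ys" for ys q
  proof (cases "set ys \<subseteq> X")
    case True
    then show ?thesis
      using permutes_subset[OF q] by (intro antisymmetrization_map assms(1)) blast
  next
    case False
    then have "antisymmetrization X xs ys = 0" "antisymmetrization X xs (map q ys) = 0"
      using range[of ys] range[of "map q ys"] permutes_image[OF q] by auto
    then show ?thesis by simp
  qed
qed

lemma antisymmetrization_self: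
  assumes "set xs \<subseteq> X" "X \<subseteq> insert z (set xs)"
  shows "antisymmetrization X xs xs = 1"
proof -
  have "map p xs = xs \<longleftrightarrow> p = id" if p: "p permutes X" for p
  proof
    assume "map p xs = xs"
    then have "p x = x" if "x \<in> set xs" for x using that by (metis map_eq_conv map_ident)
    then have "p permutes {z}" using permutes_superset[OF p] assms(2) by blast
    then show "p = id" by simp
  qed simp
  then have "antisymmetrization X xs xs = (\<Sum>p | p permutes X. if p = id then 1 else 0)"
    unfolding antisymmetrization_def by (intro sum.cong) (auto simp: sign_id)
  also have "\<dots> = 1"
    using finite_subset[OF assms(2)] by (simp add: finite_permutations permutes_id)
  finally show ?thesis .
qed

text \<open>The two cases of interest are \<open>X = A\<close> and \<open>X = insert z A\<close> with \<open>z \<notin> B\<close>.\<close>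

lemma antisymmetrization_sorted_list:
  fixes A B :: "'a::linorder set"
  assumes X: "finite X" "A \<subseteq> X" "X \<subseteq> insert z A"
    and B: "finite B" "card B = card A" "B \<inter> X \<subseteq> A"
  shows "antisymmetrization X (sorted_list_of_set A) (sorted_list_of_set B)
    = (if B = A then 1 else 0)" (is "?f = _")
proof -
  have fin: "finite A" using X finite_subset by blast
  have "B = A" if nz: "?f \<noteq> 0"
  proof -
    obtain p where p: "p permutes X" "map p (sorted_list_of_set A) = sorted_list_of_set B"
      using nz by (rule antisymmetrization_nonzeroE)
    have "p ` A = B" using arg_cong[OF p(2), of set] fin B(1) by simp
    then have "B \<subseteq> A" using permutes_image[OF p(1)] X(2) B(3) by blast
    then show ?thesis using fin B(2) by (simp add: card_subset_eq)
  qed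
  then show ?thesis using antisymmetrization_self[of "sorted_list_of_set A" X z] X fin by auto
qed

definition wedge_list :: "'a list \<Rightarrow> 'a list \<Rightarrow> real" where
  "wedge_list xs = antisymmetrization (set xs) xs"

definition wedge :: "'a::linorder set \<Rightarrow> 'a list \<Rightarrow> real" where
  "wedge A = wedge_list (sorted_list_of_set A)"

lemma wedge_list_alternating:
  assumes "distinct xs" "set xs \<subseteq> U"
  shows "wedge_list xs \<in> alternating U (length xs)"
  unfolding wedge_list_def using assms by (intro antisymmetrization_alternating) simp_all

lemma wedge_sorted_list:
  assumes "finite A" "finite B" "card B = card A"
  shows "wedge A (sorted_list_of_set B) = (if B = A then 1 else 0)"
  unfolding wedge_def wedge_list_def set_sorted_list_of_set[OF assms(1)] using assms
  by (intro antisymmetrization_sorted_list subset_insertI) auto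

lemma alternating_apply_eq_0I:
  fixes U :: "'a::linorder set"
  assumes f: "f \<in> alternating U r"
    and zero: "set ys \<subseteq> U \<Longrightarrow> card (set ys) = r \<Longrightarrow> f (sorted_list_of_set (set ys)) = 0"
  shows "f ys = 0"
proof (rule ccontr)
  assume nz: "f ys \<noteq> 0"
  then have "f (sorted_list_of_set (set ys)) = 0"
    using alternatingD(1-3)[OF f nz] by (intro zero) (simp_all add: distinct_card)
  then show False
    using alternating_eq_0_cong[OF f, of "sorted_list_of_set (set ys)" ys] nz by simp
qed

lemma reproducing_alternating:
  fixes U :: "'a::linorder set"
  assumes "finite U"
  shows "reproducing (alternating U r) {A. A \<subseteq> U \<and> card A = r} wedge
    (\<lambda>A f. f (sorted_list_of_set A))" (is "reproducing ?V ?I _ _")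
  unfolding reproducing_def
proof (intro conjI ballI)
  show fin: "finite ?I" using assms by simp
  have fin_mem: "finite A" if "A \<in> ?I" for A using that assms finite_subset by blast
  show wedge: "wedge A \<in> ?V" if "A \<in> ?I" for A
    using that fin_mem[OF that] wedge_list_alternating[of "sorted_list_of_set A" U]
    by (simp add: wedge_def)
  show "linear_form (\<lambda>f. f (sorted_list_of_set A))" for A by (rule linear_form_apply)
  fix f assume f: "f \<in> ?V"
  let ?g = "\<Sum>A\<in>?I. f (sorted_list_of_set A) *\<^sub>F wedge A"
  have "f - ?g = 0"
  proof
    have diff: "f - ?g \<in> ?V"
      using f wedge
      by (intro fun_vs.subspace_diff fun_vs.subspace_sum fun_vs.subspace_scale
          subspace_alternating)
    have zero: "(f - ?g) (sorted_list_of_set B) = 0" if B: "B \<in> ?I" for B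
    proof -
      have "wedge A (sorted_list_of_set B) = (if B = A then 1 else 0)" if "A \<in> ?I" for A
        using fin_mem[OF that] fin_mem[OF B] B that by (intro wedge_sorted_list) simp_all
      with fin B have "?g (sorted_list_of_set B) = f (sorted_list_of_set B)"
        by (rule sum_scale_apply_dual)
      then show ?thesis unfolding minus_apply by simp
    qed
    show "(f - ?g) ys = 0 ys" for ys
      unfolding zero_fun_apply by (rule alternating_apply_eq_0I[OF diff]) (rule zero, blast)
  qed
  then show "f = ?g" by (rule right_minus_eq[THEN iffD1])
qed

lemma alternating_subset_span_wedge:
  assumes "finite U"
  shows "alternating U r \<subseteq> fun_vs.span (wedge ` {A. A \<subseteq> U \<and> card A = r})"
  by (rule reproducing_subset_span[OF reproducing_alternating[OF assms]])

lemma span_wedge_list: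
  fixes U :: "'a::linorder set"
  assumes "finite U"
  shows "fun_vs.span {wedge_list xs |xs. distinct xs \<and> set xs \<subseteq> U \<and> length xs = r}
    = alternating U r" (is "fun_vs.span ?G = _")
proof
  have "?G \<subseteq> alternating U r" using wedge_list_alternating[of _ U] by auto
  then show "fun_vs.span ?G \<subseteq> alternating U r"
    by (rule fun_vs.span_minimal[OF _ subspace_alternating])
  have "wedge A \<in> ?G" if "A \<subseteq> U" "card A = r" for A
  proof -
    have "finite A" using that(1) assms by (rule finite_subset)
    then show ?thesis
      unfolding wedge_def using that by (intro CollectI exI[of _ "sorted_list_of_set A"]) simp
  qed
  then have "wedge ` {A. A \<subseteq> U \<and> card A = r} \<subseteq> ?G"
    by (simp only: image_subset_iff mem_Collect_eq) simp
  from order_trans[OF alternating_subset_span_wedge[OF assms] fun_vs.span_mono[OF this]]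
  show "alternating U r \<subseteq> fun_vs.span ?G" .
qed

section \<open>The boundary map\<close>

definition boundary :: "'a set \<Rightarrow> ('a list \<Rightarrow> real) \<Rightarrow> 'a list \<Rightarrow> real" where
  "boundary U f = (\<lambda>ys. \<Sum>b\<in>U. f (b # ys))"

lemma linear_boundary: "linear_map (boundary U)"
  by (rule linear_mapI) (auto simp: boundary_def sum.distrib sum_distrib_left)

lemma boundary_antisymmetrization:
  assumes "finite U" "X \<subseteq> U" "a \<in> X"
  shows "boundary U (antisymmetrization X (a # xs)) = antisymmetrization X xs"
proof
  fix ys
  have "(\<Sum>b\<in>U. if map p (a # xs) = b # ys then of_int (sign p) else 0)
      = (if map p xs = ys then of_int (sign p) else 0 :: real)" if "p permutes X" for p
  proof -
    have "p a \<in> U" using that assms(2,3) by (auto simp: permutes_in_image)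
    moreover have "(if map p (a # xs) = b # ys then of_int (sign p) else 0)
        = (if p a = b then if map p xs = ys then of_int (sign p) else 0 else 0 :: real)" for b
      by simp
    ultimately show ?thesis using assms(1) by (simp only: sum.delta') simp
  qed
  then show "boundary U (antisymmetrization X (a # xs)) ys = antisymmetrization X xs ys"
    unfolding boundary_def antisymmetrization_def by (subst sum.swap) simp
qed

lemma boundary_alternating:
  fixes U :: "'a set"
  assumes "f \<in> alternating U (Suc r)"
  shows "boundary U f \<in> alternating U r"
proof (rule alternatingI)
  note f = alternatingD[OF assms]
  show "distinct ys \<and> length ys = r \<and> set ys \<subseteq> U" if nz: "boundary U f ys \<noteq> 0" for ys
  proof -
    obtain b where "f (b # ys) \<noteq> 0"
      using sum.not_neutral_contains_not_neutral[OF nz[unfolded boundary_def]] by blast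
    then show ?thesis using f(1-3)[of "b # ys"] by simp
  qed
  fix ys :: "'a list" and q assume q: "q permutes set ys"
  have "f (b # map q ys) = of_int (sign q) * f (b # ys)" for b
  proof (cases "b \<in> set ys")
    case True
    then have "b \<in> set (map q ys)" using permutes_image[OF q] by simp
    then have "\<not> distinct (b # map q ys)" "\<not> distinct (b # ys)" using True by simp_all
    then have "f (b # map q ys) = 0" "f (b # ys) = 0" using f(1) by blast+
    then show ?thesis by simp
  next
    case False
    have "q permutes set (b # ys)" by (rule permutes_subset[OF q]) auto
    then show ?thesis using f(4)[of q "b # ys"] permutes_not_in[OF q False] by simp
  qed
  then show "boundary U f (map q ys) = of_int (sign q) * boundary U f ys"
    unfolding boundary_def by (simp add: sum_distrib_left)
qed

lemma boundary_boundary: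
  assumes "f \<in> alternating U r"
  shows "boundary U (boundary U f) = 0"
proof
  fix ys
  have "boundary U (boundary U f) ys = (\<Sum>a\<in>U. \<Sum>b\<in>U. f (b # a # ys))"
    by (simp add: boundary_def)
  also have "\<dots> = (\<Sum>b\<in>U. \<Sum>a\<in>U. f (b # a # ys))" by (rule sum.swap)
  also have "\<dots> = (\<Sum>b\<in>U. \<Sum>a\<in>U. - f (a # b # ys))"
    by (intro sum.cong refl alternating_swap[OF assms])
  also have "\<dots> = - boundary U (boundary U f) ys"
    by (simp add: boundary_def sum_negf)
  finally show "boundary U (boundary U f) ys = 0 ys" by simp
qed

lemma alternating_cycle_eq_0I:
  fixes U :: "'a::linorder set"
  assumes U: "finite U" "z \<in> U" and f: "f \<in> alternating U r" "boundary U f = 0"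
    and zero: "\<And>A. A \<subseteq> U - {z} \<Longrightarrow> card A = r \<Longrightarrow> f (sorted_list_of_set A) = 0"
  shows "f = 0"
proof
  have avoid: "f ys = 0" if "z \<notin> set ys" for ys
    by (rule alternating_apply_eq_0I[OF f(1)], rule zero) (use that in auto)
  fix ys
  show "f ys = 0 ys"
  proof (cases "distinct ys \<and> z \<in> set ys")
    case True
    define as where "as = remove1 z ys"
    have ys: "distinct (z # as)" "set (z # as) = set ys" using True by (auto simp: as_def)
    have "f (b # as) = 0" if "b \<noteq> z" for b
      using that ys(1) by (intro avoid) auto
    then have "boundary U f as = f (z # as)"
      unfolding boundary_def using U by (subst sum.remove[of _ z]) auto
    then have "f (z # as) = 0" using f(2) by simp
    then have "f ys = 0" using alternating_eq_0_cong[OF f(1)] ys by blast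
    then show ?thesis by simp
  next
    case False
    then have "f ys = 0" using avoid[of ys] alternatingD(1)[OF f(1)] by blast
    then show ?thesis by simp
  qed
qed

definition boundaries :: "'a set \<Rightarrow> nat \<Rightarrow> ('a list \<Rightarrow> real) set" where
  "boundaries U r = boundary U ` alternating U (Suc r)"

lemma subspace_boundaries: "fun_vs.subspace (boundaries U r)"
  unfolding boundaries_def
  by (rule fun_pair.linear_subspace_image[OF linear_boundary subspace_alternating])

lemma boundaries_subset_alternating: "boundaries U r \<subseteq> alternating U r"
  unfolding boundaries_def using boundary_alternating by blast

definition cone :: "'a::linorder \<Rightarrow> 'a set \<Rightarrow> 'a list \<Rightarrow> real" where
  "cone z A = wedge_list (z # sorted_list_of_set A)"

lemma cone_alternating:
  assumes "finite A" "A \<subseteq> U - {z}" "z \<in> U"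
  shows "cone z A \<in> alternating U (Suc (card A))"
  using wedge_list_alternating[of "z # sorted_list_of_set A" U] assms
  by (auto simp: cone_def)

lemma boundary_cone_sorted_list:
  assumes "finite U" "z \<in> U" "A \<subseteq> U - {z}" "B \<subseteq> U - {z}" "card B = card A"
  shows "boundary U (cone z A) (sorted_list_of_set B) = (if B = A then 1 else 0)"
proof -
  have fin: "finite A" "finite B" using assms finite_subset by blast+
  moreover have "boundary U (cone z A) = antisymmetrization (insert z A) (sorted_list_of_set A)"
    using assms fin by (simp add: cone_def wedge_list_def) (intro boundary_antisymmetrization, auto)
  ultimately show ?thesis
    using assms by (simp only:, intro antisymmetrization_sorted_list[of _ _ z]) auto
qed

text \<open>Coning with the base point \<open>z\<close> contracts the complex.\<close>

lemma cycle_in_boundaries: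
  fixes U :: "'a::linorder set"
  assumes U: "finite U" "z \<in> U" and f: "f \<in> alternating U r" "boundary U f = 0"
  shows "f \<in> boundaries U r"
proof -
  let ?I = "{A. A \<subseteq> U - {z} \<and> card A = r}"
  define g where "g = (\<Sum>A\<in>?I. f (sorted_list_of_set A) *\<^sub>F cone z A)"
  have fin: "finite ?I" using U(1) by simp
  have "cone z A \<in> alternating U (Suc r)" if "A \<in> ?I" for A
    using cone_alternating[of A U z] that U finite_subset[of A U] by auto
  then have g: "g \<in> alternating U (Suc r)"
    unfolding g_def by (intro fun_vs.subspace_sum fun_vs.subspace_scale subspace_alternating)
  have bd: "boundary U g = (\<Sum>A\<in>?I. f (sorted_list_of_set A) *\<^sub>F boundary U (cone z A))"
    unfolding g_def by (rule linear_map_sum_scale[OF linear_boundary])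
  have "f - boundary U g = 0"
  proof (rule alternating_cycle_eq_0I[OF U])
    show "f - boundary U g \<in> alternating U r"
      using f(1) boundary_alternating[OF g] by (intro fun_vs.subspace_diff subspace_alternating)
    show "boundary U (f - boundary U g) = 0"
      by (simp add: fun_pair.linear_diff[OF linear_boundary] f(2) boundary_boundary[OF g])
    fix B assume "B \<subseteq> U - {z}" "card B = r"
    then have B: "B \<in> ?I" by blast
    have "boundary U (cone z A) (sorted_list_of_set B) = (if B = A then 1 else 0)"
      if "A \<in> ?I" for A
      using that B by (intro boundary_cone_sorted_list[OF U]) auto
    with fin B have "boundary U g (sorted_list_of_set B) = f (sorted_list_of_set B)"
      unfolding bd by (rule sum_scale_apply_dual)
    then show "(f - boundary U g) (sorted_list_of_set B) = 0" unfolding minus_apply by simp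
  qed
  then have "f = boundary U g" by (rule right_minus_eq[THEN iffD1])
  then show ?thesis unfolding boundaries_def using g by blast
qed

lemma boundary_kernel:
  fixes U :: "'a::linorder set"
  assumes "finite U" "U \<noteq> {}"
  shows "{f \<in> alternating U r. boundary U f = 0} = boundaries U r"
proof
  show "boundaries U r \<subseteq> {f \<in> alternating U r. boundary U f = 0}"
    using boundaries_subset_alternating boundary_boundary unfolding boundaries_def by blast
  show "{f \<in> alternating U r. boundary U f = 0} \<subseteq> boundaries U r"
    using assms cycle_in_boundaries by blast
qed

section \<open>Traces on alternating functions\<close>

definition list_action :: "('a \<Rightarrow> 'a) \<Rightarrow> ('a list \<Rightarrow> real) \<Rightarrow> 'a list \<Rightarrow> real" where
  "list_action s f = (\<lambda>ys. f (map (inv_into UNIV s) ys))"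

lemma linear_list_action: "linear_map (list_action s)"
  by (rule linear_mapI) (auto simp: list_action_def)

lemma list_action_alternating:
  fixes U :: "'a set"
  assumes "s permutes U" "f \<in> alternating U r"
  shows "list_action s f \<in> alternating U r"
proof (rule alternatingI)
  let ?i = "inv_into UNIV s"
  have i: "?i permutes U" by (rule permutes_inv[OF assms(1)])
  have inj: "inj_on ?i A" for A using permutes_inj[OF i] inj_on_subset by blast
  note f = alternatingD[OF assms(2)]
  show "distinct ys \<and> length ys = r \<and> set ys \<subseteq> U" if "list_action s f ys \<noteq> 0" for ys
  proof -
    have nz: "f (map ?i ys) \<noteq> 0" using that by (simp add: list_action_def)
    show ?thesis
      using f(1)[OF nz] f(2)[OF nz] f(3)[OF nz] permutes_in_image[OF i]
      by (auto simp: distinct_map)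
  qed
  fix ys :: "'a list" and q assume q: "q permutes set ys"
  let ?q = "map_permutation (set ys) ?i q"
  have "map ?i (map q ys) = map ?q (map ?i ys)"
    using inj by (simp add: map_permutation_apply)
  moreover have "?q permutes set (map ?i ys)"
    using map_permutation_permutes[OF inj_on_imp_bij_betw[OF inj] q] by simp
  moreover have "sign ?q = sign q" using sign_map_permutation[OF inj q] by simp
  ultimately show "list_action s f (map q ys) = of_int (sign q) * list_action s f ys"
    using f(4)[of ?q "map ?i ys"] unfolding list_action_def by (simp del: map_map)
qed

lemma boundary_list_action:
  assumes "s permutes U"
  shows "boundary U (list_action s f) = list_action s (boundary U f)"
  unfolding boundary_def list_action_def
  using sum.permute[OF permutes_inv[OF assms], of "\<lambda>b. f (b # _)"] by (simp add: o_def)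

lemma list_action_boundaries:
  assumes "s permutes U"
  shows "list_action s ` boundaries U r \<subseteq> boundaries U r"
  unfolding boundaries_def
  using list_action_alternating[OF assms] boundary_list_action[OF assms, symmetric] by blast

lemma wedge_list_action_apply:
  assumes "s permutes U"
  shows "list_action s (wedge_list xs) xs
    = (if s ` set xs = set xs then of_int (sign (perm_restrict s (set xs))) else 0)"
proof (cases "s ` set xs = set xs")
  case True
  let ?r = "perm_restrict s (set xs)"
  have r: "?r permutes set xs" by (rule perm_restrict_permutes[OF assms True])
  have "inv_into UNIV s x = inv_into UNIV ?r x" if "x \<in> set xs" for x
  proof -
    have "inv_into UNIV ?r x \<in> set xs" using that permutes_in_image[OF permutes_inv[OF r]] by simp
    then have "s (inv_into UNIV ?r x) = x"
      using permutes_inverses(1)[OF r, of x] by (simp add: perm_restrict_simps)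
    then show ?thesis using permutes_inverses(2)[OF assms] by metis
  qed
  then have inv_eq: "map (inv_into UNIV s) xs = map (inv_into UNIV ?r) xs" by simp
  have "sign (inv_into UNIV ?r) = sign ?r"
    using r by (intro sign_inverse) (auto simp: permutation_permutes)
  then show ?thesis
    unfolding list_action_def wedge_list_def inv_eq
      antisymmetrization_map[OF finite_set permutes_inv[OF r]]
    using True antisymmetrization_self[OF order_refl subset_insertI, of xs] by simp
next
  case False
  have "list_action s (wedge_list xs) xs = 0"
  proof (rule ccontr)
    assume "list_action s (wedge_list xs) xs \<noteq> 0"
    then obtain p where p: "p permutes set xs" "map p xs = map (inv_into UNIV s) xs"
      unfolding list_action_def wedge_list_def by (rule antisymmetrization_nonzeroE)
    have "inv_into UNIV s ` set xs = set xs"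
      using arg_cong[OF p(2), of set] permutes_image[OF p(1)] by simp
    then have "s ` inv_into UNIV s ` set xs = s ` set xs" by simp
    then show False
      using False permutes_surj[OF assms] by (simp add: image_image surj_f_inv_f)
  qed
  then show ?thesis using False by simp
qed

lemma trace_alternating:
  fixes U :: "'a::linorder set"
  assumes "finite U" "s permutes U"
  shows "trace_on (alternating U r) (list_action s)
    = (\<Sum>A\<in>invariant_sets U s. if card A = r then of_int (sign (perm_restrict s A)) else 0)"
proof -
  have "list_action s ` alternating U r \<subseteq> alternating U r"
    using list_action_alternating[OF assms(2)] by blast
  then have "trace_on (alternating U r) (list_action s)
      = (\<Sum>A | A \<subseteq> U \<and> card A = r. list_action s (wedge A) (sorted_list_of_set A))"
    by (rule trace_on_eq_sum[OF subspace_alternating linear_list_action _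
          reproducing_alternating[OF assms(1)]])
  also have "\<dots> = (\<Sum>A | A \<subseteq> U \<and> card A = r.
      if s ` A = A then of_int (sign (perm_restrict s A)) else 0)"
  proof (rule sum.cong[OF refl])
    fix A assume "A \<in> {A. A \<subseteq> U \<and> card A = r}"
    then show "list_action s (wedge A) (sorted_list_of_set A)
        = (if s ` A = A then of_int (sign (perm_restrict s A)) else 0)"
      using wedge_list_action_apply[OF assms(2), of "sorted_list_of_set A"]
        finite_subset[OF _ assms(1)] by (auto simp: wedge_def)
  qed
  also have "\<dots> = (\<Sum>A\<in>invariant_sets U s.
      if card A = r then of_int (sign (perm_restrict s A)) else 0)"
    unfolding invariant_sets_def using assms(1) by (intro sum.mono_neutral_cong) auto
  finally show ?thesis .
qed

context
  fixes U :: "'a::linorder set" and s :: "'a \<Rightarrow> 'a"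
  assumes U: "finite U" "U \<noteq> {}" and s: "s permutes U"
begin

lemma trace_boundaries_0:
  "trace_on (boundaries U 0) (list_action s) = trace_on (alternating U 0) (list_action s)"
proof -
  have "boundary U f = 0" if "f \<in> alternating U 0" for f
    using alternatingD(2)[OF that] unfolding boundary_def
    by (intro ext) (auto intro!: sum.neutral)
  then have "boundaries U 0 = alternating U 0" using boundary_kernel[OF U, of 0] by blast
  then show ?thesis by simp
qed

lemma trace_boundaries_Suc:
  "trace_on (boundaries U (Suc r)) (list_action s) + trace_on (boundaries U r) (list_action s)
    = trace_on (alternating U (Suc r)) (list_action s)"
proof -
  let ?V = "alternating U (Suc r)"
  have "list_action s ` ?V \<subseteq> ?V" using list_action_alternating[OF s] by blast
  then have "trace_on ?V (list_action s) = trace_on {f \<in> ?V. boundary U f = 0} (list_action s)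
      + trace_on (boundary U ` ?V) (list_action s)"
    by (intro trace_on_kernel_image[OF subspace_alternating
          alternating_subset_span_wedge[OF U(1)] _ linear_boundary linear_list_action _
          linear_list_action] boundary_list_action[OF s]) (use U(1) in simp_all)
  then show ?thesis unfolding boundary_kernel[OF U] boundaries_def[symmetric] by simp
qed

text \<open>Solving this recursion divides the generating function of the traces on the exterior powers
  by \<open>1 + q\<close>.\<close>

lemma trace_boundaries:
  "trace_on (boundaries U r) (list_action s) = (\<Sum>A\<in>invariant_sets U s.
     geometric_coeff (int r - int (card A)) * of_int (sign (perm_restrict s A)))"
proof (induction r)
  case 0
  have "geometric_coeff (int 0 - int n) = (if n = 0 then 1 else 0)" for n
    by (simp add: geometric_coeff_def)
  then show ?case unfolding trace_boundaries_0 trace_alternating[OF U(1) s]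
    by (auto intro!: sum.cong)
next
  case (Suc r)
  let ?w = "\<lambda>r A. geometric_coeff (int r - int (card A)) * real_of_int (sign (perm_restrict s A))"
  have "?w (Suc r) A + ?w r A
      = (if card A = Suc r then of_int (sign (perm_restrict s A)) else 0)" for A
  proof -
    have "int (Suc r) - int (card A) = int r - int (card A) + 1" by simp
    then have "?w (Suc r) A + ?w r A
        = (if int r - int (card A) = - 1 then 1 else 0) * of_int (sign (perm_restrict s A))"
      by (simp only: geometric_coeff_plus_1 flip: distrib_right)
    then show ?thesis by auto
  qed
  then have "(\<Sum>A\<in>invariant_sets U s. ?w (Suc r) A) + (\<Sum>A\<in>invariant_sets U s. ?w r A)
      = trace_on (alternating U (Suc r)) (list_action s)"
    unfolding trace_alternating[OF U(1) s] by (simp flip: sum.distrib)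
  then show ?case using trace_boundaries_Suc[of r] Suc by linarith
qed

lemma trace_boundaries_eq_hook_char:
  assumes "j \<le> card U"
  shows "trace_on (boundaries U (card U - j)) (list_action s) = hook_char U s (int j)"
proof -
  have "int (card (U - A)) - int j = int (card U - j) - int (card A)"
    if "A \<in> invariant_sets U s" for A
  proof -
    have A: "A \<subseteq> U" "card A \<le> card U"
      using that U(1) card_mono unfolding invariant_sets_def by blast+
    then have "card (U - A) = card U - card A"
      using U(1) by (intro card_Diff_subset) (auto intro: finite_subset)
    then show ?thesis using A(2) assms by simp
  qed
  then show ?thesis unfolding trace_boundaries hook_char_def hook_weight_def by simp
qed

end

section \<open>Specht modules of hooks\<close>

definition hook_tabloid :: "'a set \<Rightarrow> 'a list \<Rightarrow> 'a set list" where
  "hook_tabloid U xs = (U - set xs) # map (\<lambda>x. {x}) xs"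

lemma inj_hook_tabloid: "inj (hook_tabloid U)"
  by (rule injI) (auto simp: hook_tabloid_def inj_map_eq_map[OF inj_singleton])

lemma map_image_hook_tabloid:
  assumes "s permutes U"
  shows "map ((`) s) (hook_tabloid U xs) = hook_tabloid U (map s xs)"
  using permutes_image[OF assms] image_set_diff[OF permutes_inj[OF assms], of U "set xs"]
  unfolding hook_tabloid_def by simp

definition lift_tabloid :: "'a set \<Rightarrow> ('a list \<Rightarrow> real) \<Rightarrow> 'a set list \<Rightarrow> real" where
  "lift_tabloid U f X =
    (let xs = map the_elem (tl X) in if X = hook_tabloid U xs then f xs else 0)"

lemma lift_tabloid_apply [simp]: "lift_tabloid U f (hook_tabloid U xs) = f xs"
  by (simp add: lift_tabloid_def hook_tabloid_def o_def)

lemma lift_tabloid_outside: "X \<notin> range (hook_tabloid U) \<Longrightarrow> lift_tabloid U f X = 0"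
  by (auto simp: lift_tabloid_def Let_def)

lemma lift_tabloid_eqI:
  assumes "\<And>xs. F (hook_tabloid U xs) = f xs" "\<And>X. X \<notin> range (hook_tabloid U) \<Longrightarrow> F X = 0"
  shows "F = lift_tabloid U f"
proof
  fix X show "F X = lift_tabloid U f X"
    using assms by (cases "X \<in> range (hook_tabloid U)") (auto simp: lift_tabloid_outside)
qed

lemma linear_lift_tabloid: "linear_map (lift_tabloid U)"
  by (rule linear_mapI) (auto simp: lift_tabloid_def Let_def)

lemma inj_lift_tabloid: "inj (lift_tabloid U)"
  by (rule injI) (metis ext lift_tabloid_apply)

lemma linear_perm_act: "linear_map (perm_act s)"
  by (rule linear_mapI) (auto simp: perm_act_def)

lemma perm_act_lift_tabloid:
  assumes "s permutes U"
  shows "perm_act s (lift_tabloid U f) = lift_tabloid U (list_action s f)"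
proof (rule lift_tabloid_eqI)
  show "perm_act s (lift_tabloid U f) (hook_tabloid U xs) = list_action s f xs" for xs
    unfolding perm_act_def list_action_def map_image_hook_tabloid[OF permutes_inv[OF assms]]
    by simp
next
  fix X assume X: "X \<notin> range (hook_tabloid U)"
  have "map ((`) (inv_into UNIV s)) X \<notin> range (hook_tabloid U)"
  proof
    assume "map ((`) (inv_into UNIV s)) X \<in> range (hook_tabloid U)"
    then obtain xs where xs: "map ((`) (inv_into UNIV s)) X = hook_tabloid U xs" by blast
    have "X = map ((`) s) (map ((`) (inv_into UNIV s)) X)"
      using permutes_surj[OF assms] by (simp add: o_def image_image surj_f_inv_f)
    then have "X = hook_tabloid U (map s xs)" unfolding xs map_image_hook_tabloid[OF assms] .
    then show False using X by blast
  qed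
  then show "perm_act s (lift_tabloid U f) X = 0"
    unfolding perm_act_def by (rule lift_tabloid_outside)
qed

context
  fixes j m :: nat
  assumes j: "1 \<le> j" "j \<le> m"
begin

definition first_column :: "(nat \<times> nat \<Rightarrow> nat) \<Rightarrow> nat list" where
  "first_column t = map (\<lambda>i. t (i, 0)) [0..<Suc (m - j)]"

lemma sum_list_hook: "sum_list (hook j m) = m"
  using j by (simp add: hook_def sum_list_replicate)

lemma mem_cells_hook:
  "(i, c) \<in> cells (hook j m) \<longleftrightarrow> i \<le> m - j \<and> (if i = 0 then c < j else c = 0)"
  unfolding cells_def hook_def by (cases i) auto

lemma cells_hook:
  "cells (hook j m) = (\<lambda>i. (i, 0)) ` {0..<Suc (m - j)} \<union> (\<lambda>c. (0, c)) ` {1..<j}"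
  using j by (auto simp: mem_cells_hook image_iff split: if_splits)

lemma first_column_eq_Cons: "first_column t = t (0, 0) # tl (first_column t)"
  by (simp add: first_column_def upt_conv_Cons del: upt_Suc)

lemma tl_first_column: "tl (first_column t) = map (\<lambda>i. t (Suc i, 0)) [0..<m - j]"
  by (simp add: first_column_def upt_conv_Cons map_Suc_upt[symmetric] o_def del: upt_Suc)

lemma mem_set_first_column: "x \<in> set (first_column t) \<longleftrightarrow> (\<exists>i\<le>m - j. x = t (i, 0))"
  by (auto simp: first_column_def less_Suc_eq_le simp del: upt_Suc)

lemma length_first_column: "length (first_column t) = Suc (m - j)"
  by (simp add: first_column_def)

lemma first_column_comp: "first_column (p \<circ> t) = map p (first_column t)"
  by (simp add: first_column_def)

lemma is_tableau_comp:
  assumes "is_tableau (hook j m) t" "p permutes {0..<m}"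
  shows "is_tableau (hook j m) (p \<circ> t)"
  using assms bij_betw_trans permutes_imp_bij unfolding is_tableau_def sum_list_hook by blast

lemma tableau_first_column:
  assumes "is_tableau (hook j m) t"
  shows "distinct (first_column t)" "set (first_column t) \<subseteq> {0..<m}"
    and "{0..<m} - set (first_column t) = (\<lambda>c. t (0, c)) ` {1..<j}"
proof -
  have inj: "inj_on t (cells (hook j m))" and img: "t ` cells (hook j m) = {0..<m}"
    using assms unfolding is_tableau_def sum_list_hook by (auto simp: bij_betw_def)
  let ?stem = "(\<lambda>i. (i, 0)) ` {0..<Suc (m - j)}" and ?arm = "(\<lambda>c. (0, c)) ` {1..<j}"
  have stem: "set (first_column t) = t ` ?stem"
    by (simp only: first_column_def set_map set_upt image_image)
  show "distinct (first_column t)"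
    unfolding first_column_def distinct_map
  proof
    have "inj_on t ?stem" by (rule inj_on_subset[OF inj]) (simp add: cells_hook)
    then have "inj_on (t \<circ> (\<lambda>i. (i, 0))) {0..<Suc (m - j)}"
      by (intro comp_inj_on) (simp_all add: inj_on_def)
    then show "inj_on (\<lambda>i. t (i, 0)) (set [0..<Suc (m - j)])" unfolding o_def set_upt .
  qed simp
  show "set (first_column t) \<subseteq> {0..<m}"
    unfolding stem img[symmetric] cells_hook by (rule image_mono) blast
  have "{0..<m} - set (first_column t) = t ` (cells (hook j m) - ?stem)"
    unfolding stem img[symmetric]
    by (rule inj_on_image_set_diff[OF inj, symmetric]) (auto simp: cells_hook)
  also have "cells (hook j m) - ?stem = ?arm" unfolding cells_hook by auto
  finally show "{0..<m} - set (first_column t) = (\<lambda>c. t (0, c)) ` {1..<j}"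
    by (simp only: image_image)
qed

lemma tabloid_hook:
  assumes "is_tableau (hook j m) t"
  shows "tabloid (hook j m) t = hook_tabloid {0..<m} (tl (first_column t))"
proof -
  let ?row = "\<lambda>i. {t (i, c) |c. c < hook j m ! i}"
  note t = tableau_first_column[OF assms]
  have "t (0, 0) \<in> {0..<m}" "t (0, 0) \<notin> set (tl (first_column t))"
    using t(1,2) first_column_eq_Cons[of t] by (metis distinct.simps(2) list.set_intros(1) subsetD)+
  moreover have "set (first_column t) = insert (t (0, 0)) (set (tl (first_column t)))"
    using first_column_eq_Cons[of t] by (metis list.simps(15))
  ultimately have "{0..<m} - set (tl (first_column t))
      = insert (t (0, 0)) ({0..<m} - set (first_column t))" by blast
  also have "\<dots> = (\<lambda>c. t (0, c)) ` insert 0 {1..<j}" unfolding t(3) by simp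
  also have "insert 0 {1..<j} = {0..<j}" using j by auto
  also have "(\<lambda>c. t (0, c)) ` {0..<j} = ?row 0" by (auto simp: hook_def)
  finally have row_0: "{0..<m} - set (tl (first_column t)) = ?row 0" .
  have rows: "map (?row \<circ> Suc) [0..<m - j] = map (\<lambda>x. {x}) (tl (first_column t))"
    unfolding tl_first_column map_map by (rule map_cong[OF refl]) (auto simp: hook_def)
  have "tabloid (hook j m) t = map ?row (0 # map Suc [0..<m - j])"
    unfolding tabloid_def map_Suc_upt by (simp add: hook_def upt_conv_Cons del: upt_Suc)
  then show ?thesis unfolding hook_tabloid_def using row_0 rows by simp
qed

lemma column_stabilizer_hook:
  assumes "is_tableau (hook j m) t"
  shows "column_stabilizer (hook j m) t = {p. p permutes set (first_column t)}"
proof (intro equalityI subsetI CollectI)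
  note t = tableau_first_column[OF assms]
  fix p assume "p \<in> column_stabilizer (hook j m) t"
  then have p: "p permutes {0..<m}"
    "\<And>i c. (i, c) \<in> cells (hook j m)
      \<Longrightarrow> \<exists>i'. (i', c) \<in> cells (hook j m) \<and> p (t (i, c)) = t (i', c)"
    unfolding column_stabilizer_def sum_list_hook by auto
  have "p x = x" if x: "x \<in> {0..<m} - set (first_column t)" for x
  proof -
    obtain c where c: "1 \<le> c" "c < j" "x = t (0, c)" using x unfolding t(3) by auto
    then obtain i where "(i, c) \<in> cells (hook j m)" "p x = t (i, c)"
      using p(2)[of 0 c] by (auto simp: mem_cells_hook)
    then show ?thesis using c by (auto simp: mem_cells_hook split: if_splits)
  qed
  then show "p permutes set (first_column t)" using permutes_superset[OF p(1)] by blast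
next
  note t = tableau_first_column[OF assms]
  fix p assume "p \<in> {p. p permutes set (first_column t)}"
  then have p: "p permutes set (first_column t)" by simp
  have "\<exists>i'. (i', c) \<in> cells (hook j m) \<and> p (t (i, c)) = t (i', c)"
    if ic: "(i, c) \<in> cells (hook j m)" for i c
  proof (cases "c = 0")
    case True
    have "t (i, 0) \<in> set (first_column t)"
      using ic by (auto simp: mem_set_first_column mem_cells_hook)
    then have "p (t (i, 0)) \<in> set (first_column t)" using permutes_in_image[OF p] by blast
    then obtain i' where "i' \<le> m - j" "p (t (i, 0)) = t (i', 0)"
      unfolding mem_set_first_column by blast
    then show ?thesis using True j by (intro exI[of _ i']) (simp add: mem_cells_hook)
  next
    case False
    then have "i = 0" "c < j" using ic by (auto simp: mem_cells_hook split: if_splits)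
    then have "t (i, c) \<notin> set (first_column t)" using False t(3) by force
    then show ?thesis using ic permutes_not_in[OF p] by auto
  qed
  then show "p \<in> column_stabilizer (hook j m) t"
    unfolding column_stabilizer_def sum_list_hook using permutes_subset[OF p t(2)] by auto
qed

lemma polytabloid_hook:
  assumes "is_tableau (hook j m) t"
  shows "polytabloid (hook j m) t
    = lift_tabloid {0..<m} (boundary {0..<m} (wedge_list (first_column t)))"
proof -
  note t = tableau_first_column[OF assms]
  let ?col = "first_column t" and ?U = "{0..<m}"
  have "tabloid (hook j m) (p \<circ> t) = hook_tabloid ?U (map p (tl ?col))"
    if "p permutes set ?col" for p
    using tabloid_hook[OF is_tableau_comp[OF assms permutes_subset[OF that t(2)]]]
    by (simp add: first_column_comp map_tl)
  then have poly: "polytabloid (hook j m) t X = (\<Sum>p | p permutes set ?col.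
      if X = hook_tabloid ?U (map p (tl ?col)) then of_int (sign p) else 0)" for X
    unfolding polytabloid_def column_stabilizer_hook[OF assms] by (intro sum.cong) simp_all
  let ?anti = "antisymmetrization (set ?col) (tl ?col)"
  have "polytabloid (hook j m) t = lift_tabloid ?U ?anti"
  proof (rule lift_tabloid_eqI)
    show "polytabloid (hook j m) t (hook_tabloid ?U xs) = ?anti xs" for xs
      unfolding poly antisymmetrization_def inj_eq[OF inj_hook_tabloid] by (simp only: eq_commute)
    show "polytabloid (hook j m) t X = 0" if "X \<notin> range (hook_tabloid ?U)" for X
      unfolding poly using that by (intro sum.neutral) auto
  qed
  also have "?anti = boundary ?U (wedge_list ?col)"
    unfolding wedge_list_def
    using boundary_antisymmetrization[OF _ t(2), of "t (0, 0)" "tl ?col"] first_column_eq_Cons[of t]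
    by (metis finite_atLeastLessThan list.set_intros(1))
  finally show ?thesis .
qed

lemma ex_tableau_first_column:
  assumes "distinct xs" "set xs \<subseteq> {0..<m}" "length xs = Suc (m - j)"
  obtains t where "is_tableau (hook j m) t" "first_column t = xs"
proof -
  have "card ({0..<m} - set xs) = card {1..<j}"
    using assms j distinct_card[OF assms(1)] by (subst card_Diff_subset) auto
  then obtain g where g: "bij_betw g {1..<j} ({0..<m} - set xs)"
    using finite_same_card_bij[of "{1..<j}" "{0..<m} - set xs"] by auto
  define t where "t = (\<lambda>(i, c). if c = 0 then xs ! i else g c)"
  let ?stem = "(\<lambda>i. (i, 0)) ` {0..<Suc (m - j)}" and ?arm = "(\<lambda>c. (0, c)) ` {1..<j}"
  have col: "first_column t = xs"
    by (rule nth_equalityI)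
      (use assms(3) in \<open>auto simp: t_def first_column_def simp del: upt_Suc\<close>)
  have "bij_betw (\<lambda>i. xs ! i) {0..<Suc (m - j)} (set xs)"
    using assms(1,3) by (intro bij_betw_nth) auto
  then have "bij_betw t ?stem (set xs)"
    by (auto simp: bij_betw_def inj_on_def t_def image_image)
  moreover have "bij_betw (\<lambda>c. t (0, c)) {1..<j} ({0..<m} - set xs)"
    using g by (subst bij_betw_cong[of _ _ g]) (auto simp: t_def)
  then have "bij_betw t ?arm ({0..<m} - set xs)"
    by (auto simp: bij_betw_def inj_on_def image_image)
  ultimately have "bij_betw t (?stem \<union> ?arm) (set xs \<union> ({0..<m} - set xs))"
    by (rule bij_betw_combine) blast
  moreover have "set xs \<union> ({0..<m} - set xs) = {0..<m}" using assms(2) by blast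
  ultimately have "is_tableau (hook j m) t" unfolding is_tableau_def sum_list_hook cells_hook by simp
  then show ?thesis using col that by blast
qed

lemma specht_module_hook:
  "specht_module (hook j m) = lift_tabloid {0..<m} ` boundaries {0..<m} (m - j)"
proof -
  let ?U = "{0..<m}" and ?F = "\<lambda>f. lift_tabloid {0..<m} (boundary {0..<m} f)"
  let ?G = "{wedge_list xs |xs. distinct xs \<and> set xs \<subseteq> ?U \<and> length xs = Suc (m - j)}"
  have "{polytabloid (hook j m) t |t. is_tableau (hook j m) t} = ?F ` ?G"
  proof (intro equalityI subsetI)
    fix F assume "F \<in> {polytabloid (hook j m) t |t. is_tableau (hook j m) t}"
    then obtain t where t: "is_tableau (hook j m) t" "F = polytabloid (hook j m) t" by blast
    show "F \<in> ?F ` ?G"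
      unfolding t(2) polytabloid_hook[OF t(1)]
      using tableau_first_column(1,2)[OF t(1)] length_first_column[of t] by blast
  next
    fix F assume "F \<in> ?F ` ?G"
    then obtain xs where xs: "F = ?F (wedge_list xs)"
      "distinct xs" "set xs \<subseteq> ?U" "length xs = Suc (m - j)" by blast
    obtain t where "is_tableau (hook j m) t" "first_column t = xs"
      using ex_tableau_first_column[OF xs(2-4)] .
    then have "is_tableau (hook j m) t" "F = polytabloid (hook j m) t"
      using polytabloid_hook[of t] xs(1) by simp_all
    then show "F \<in> {polytabloid (hook j m) t |t. is_tableau (hook j m) t}" by blast
  qed
  moreover have "linear_map ?F"
    using Vector_Spaces.linear_compose[OF linear_boundary linear_lift_tabloid]
    by (simp add: o_def)
  ultimately have "specht_module (hook j m) = ?F ` fun_vs.span ?G"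
    unfolding specht_module_def by (simp only: fun_pair.linear_span_image)
  also have "\<dots> = lift_tabloid ?U ` boundaries ?U (m - j)"
    by (simp add: span_wedge_list boundaries_def image_image)
  finally show ?thesis .
qed

lemma irr_char_hook:
  assumes s: "s permutes {0..<m}"
  shows "irr_char (hook j m) s = hook_char {0..<m} s (int j)"
proof -
  let ?U = "{0..<m}"
  have span: "boundaries ?U (m - j) \<subseteq> fun_vs.span (wedge ` {A. A \<subseteq> ?U \<and> card A = m - j})"
    using boundaries_subset_alternating alternating_subset_span_wedge by (rule order_trans) simp
  have "irr_char (hook j m) s
      = trace_on (lift_tabloid ?U ` boundaries ?U (m - j)) (perm_act s)"
    unfolding irr_char_def specht_module_hook ..
  also have "\<dots> = trace_on (boundaries ?U (m - j)) (list_action s)"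
    by (rule trace_on_inj_image[OF subspace_boundaries span _ linear_lift_tabloid inj_lift_tabloid
          linear_list_action list_action_boundaries[OF s] linear_perm_act
          perm_act_lift_tabloid[OF s, symmetric]]) simp
  also have "\<dots> = hook_char ?U s (int j)"
    using trace_boundaries_eq_hook_char[of ?U s j] s j by simp
  finally show ?thesis .
qed

end

section \<open>Expansion of hook immanants\<close>

lemma bij_betw_map_permutation:
  assumes f: "bij_betw f S S'"
  shows "bij_betw (map_permutation S f) {p. p permutes S} {p. p permutes S'}"
proof (rule bij_betw_byWitness[where f' = "map_permutation S' (inv_into S f)"])
  have f': "bij_betw (inv_into S f) S' S" by (rule bij_betw_inv_into[OF f])
  show "\<forall>p\<in>{p. p permutes S}. map_permutation S' (inv_into S f) (map_permutation S f p) = p"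
    using map_permutation_compose_inv[OF f] bij_betw_inv_into_left[OF f] by blast
  show "\<forall>p\<in>{p. p permutes S'}. map_permutation S f (map_permutation S' (inv_into S f) p) = p"
    using map_permutation_compose_inv[OF f'] bij_betw_inv_into_right[OF f] by blast
  show "map_permutation S f ` {p. p permutes S} \<subseteq> {p. p permutes S'}"
    using map_permutation_permutes[OF f] by blast
  show "map_permutation S' (inv_into S f) ` {p. p permutes S'} \<subseteq> {p. p permutes S}"
    using map_permutation_permutes[OF f'] by blast
qed

lemma invariant_sets_map_permutation:
  assumes f: "inj_on f S" and s: "s permutes S"
  shows "invariant_sets (f ` S) (map_permutation S f s) = (`) f ` invariant_sets S s"
proof -
  have iff: "map_permutation S f s ` f ` A = f ` A \<longleftrightarrow> s ` A = A" if "A \<subseteq> S" for A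
  proof -
    have "map_permutation S f s ` f ` A = f ` s ` A"
      unfolding image_image using that
      by (intro image_cong refl map_permutation_apply[OF f]) blast
    moreover have "s ` A \<subseteq> S" using image_mono[OF that] permutes_image[OF s] by metis
    ultimately show ?thesis using inj_on_image_eq_iff[OF f _ that] by simp
  qed
  have "invariant_sets (f ` S) (map_permutation S f s)
      = {f ` A |A. A \<subseteq> S \<and> map_permutation S f s ` f ` A = f ` A}"
    unfolding invariant_sets_def subset_image_iff by blast
  also have "\<dots> = (`) f ` invariant_sets S s"
    by (simp add: invariant_sets_def setcompr_eq_image iff cong: conj_cong)
  finally show ?thesis .
qed

lemma perm_restrict_map_permutation:
  assumes "inj_on f S" "A \<subseteq> S"
  shows "perm_restrict (map_permutation S f s) (f ` A) = map_permutation S f (perm_restrict s A)"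
proof
  fix y
  show "perm_restrict (map_permutation S f s) (f ` A) y
    = map_permutation S f (perm_restrict s A) y"
  proof (cases "y \<in> f ` S")
    case True
    then obtain x where x: "x \<in> S" "y = f x" by blast
    have "f x \<in> f ` A \<longleftrightarrow> x \<in> A" by (rule inj_on_image_mem_iff[OF assms(1) x(1) assms(2)])
    then show ?thesis using x assms(1) by (auto simp: perm_restrict_def map_permutation_apply)
  next
    case False
    then have "y \<notin> f ` A" using assms(2) by blast
    then show ?thesis using False by (simp add: perm_restrict_def map_permutation_def)
  qed
qed

lemma hook_char_map_permutation:
  assumes fin: "finite S" and f: "inj_on f S" and s: "s permutes S"
  shows "hook_char (f ` S) (map_permutation S f s) k = hook_char S s k"
proof -
  have "card (f ` S - f ` A) = card (S - A)"
    and "sign (perm_restrict (map_permutation S f s) (f ` A)) = sign (perm_restrict s A)"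
    if "A \<in> invariant_sets S s" for A
  proof -
    have A: "A \<subseteq> S" "s ` A = A" using that unfolding invariant_sets_def by auto
    have "f ` S - f ` A = f ` (S - A)" using inj_on_image_set_diff[OF f Diff_subset A(1)] by simp
    then show "card (f ` S - f ` A) = card (S - A)"
      using card_image[OF inj_on_subset[OF f Diff_subset]] by simp
    have "perm_restrict s A permutes S"
      using perm_restrict_permutes[OF s A(2)] A(1) by (rule permutes_subset)
    then show "sign (perm_restrict (map_permutation S f s) (f ` A)) = sign (perm_restrict s A)"
      unfolding perm_restrict_map_permutation[OF f A(1)] using f fin
      by (intro sign_map_permutation)
  qed
  moreover have "inj_on ((`) f) (invariant_sets S s)"
    using inj_on_image_eq_iff[OF f] unfolding invariant_sets_def by (auto intro!: inj_onI)
  ultimately show ?thesis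
    unfolding hook_char_def invariant_sets_map_permutation[OF f s]
    by (simp add: sum.reindex hook_weight_def)
qed

definition hook_immanant_on :: "'a set \<Rightarrow> int \<Rightarrow> ('a \<Rightarrow> 'a \<Rightarrow> real) \<Rightarrow> real" where
  "hook_immanant_on S k h = (\<Sum>s | s permutes S. hook_char S s k * (\<Prod>i\<in>S. h i (s i)))"

lemma hook_immanant_on_cong:
  assumes "\<And>i j. i \<in> S \<Longrightarrow> j \<in> S \<Longrightarrow> h i j = h' i j"
  shows "hook_immanant_on S k h = hook_immanant_on S k h'"
  unfolding hook_immanant_on_def
proof (rule sum.cong[OF refl])
  fix s assume "s \<in> {s. s permutes S}"
  then have "(\<Prod>i\<in>S. h i (s i)) = (\<Prod>i\<in>S. h' i (s i))"
    by (intro prod.cong) (auto simp: assms permutes_in_image)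
  then show "hook_char S s k * (\<Prod>i\<in>S. h i (s i)) = hook_char S s k * (\<Prod>i\<in>S. h' i (s i))" by simp
qed

lemma hook_immanant_on_reindex:
  assumes fin: "finite S" and f: "bij_betw f S S'"
  shows "hook_immanant_on S' k h = hook_immanant_on S k (\<lambda>i j. h (f i) (f j))"
proof -
  have inj: "inj_on f S" and img: "f ` S = S'" using f by (auto simp: bij_betw_def)
  have "hook_immanant_on S' k h = (\<Sum>s | s permutes S.
      hook_char S' (map_permutation S f s) k * (\<Prod>i\<in>S'. h i (map_permutation S f s i)))"
    unfolding hook_immanant_on_def
    by (rule sum.reindex_bij_betw[OF bij_betw_map_permutation[OF f], symmetric])
  also have "\<dots> = hook_immanant_on S k (\<lambda>i j. h (f i) (f j))"
    unfolding hook_immanant_on_def img[symmetric] prod.reindex[OF inj]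
    using hook_char_map_permutation[OF fin inj]
    by (intro sum.cong arg_cong2[where f = "(*)"] prod.cong)
      (simp_all add: map_permutation_apply[OF inj])
  finally show ?thesis .
qed

definition cyclic_perms :: "'a set \<Rightarrow> 'a \<Rightarrow> ('a \<Rightarrow> 'a) set" where
  "cyclic_perms S v = {c. orbit c v \<subseteq> S \<and> c permutes orbit c v}"

lemma cyclic_permsD:
  assumes "finite S" "c \<in> cyclic_perms S v"
  shows "orbit c v \<subseteq> S" "c permutes orbit c v" "finite (orbit c v)"
    "cyclic_on c (orbit c v)" "v \<in> orbit c v"
proof -
  show "orbit c v \<subseteq> S" and c: "c permutes orbit c v"
    using assms(2) unfolding cyclic_perms_def by auto
  then show fin: "finite (orbit c v)" using assms(1) finite_subset by blast
  show "cyclic_on c (orbit c v)" by (rule cyclic_on_orbit[OF c fin])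
  have "permutation c" using c fin permutation_permutes by blast
  then show "v \<in> orbit c v" by (rule permutation_self_in_orbit)
qed

lemma finite_cyclic_perms:
  assumes "finite S"
  shows "finite (cyclic_perms S v)"
proof (rule finite_subset[OF _ finite_permutations[OF assms]])
  show "cyclic_perms S v \<subseteq> {c. c permutes S}"
    unfolding cyclic_perms_def using permutes_subset by blast
qed

lemma orbit_restrict_comp_disjoint:
  assumes "finite S" "c \<in> cyclic_perms S v" and t: "t permutes (S - orbit c v)"
  shows "orbit (c \<circ> t) v = orbit c v" "perm_restrict (c \<circ> t) (orbit c v) = c"
    "perm_restrict (c \<circ> t) (S - orbit c v) = t"
proof -
  note c = cyclic_permsD[OF assms(1,2)]
  note ct = comp_permutes_disjoint[OF c(2) t Diff_disjoint]
  show "orbit (c \<circ> t) v = orbit c v" using c(5) ct(1) by (rule orbit_cong)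
  show "perm_restrict (c \<circ> t) (orbit c v) = c"
    using perm_restrict_comp_disjoint(2)[OF c(2) t Diff_disjoint empty_subsetI]
    by (simp add: perm_restrict_def fun_eq_iff)
  show "perm_restrict (c \<circ> t) (S - orbit c v) = t"
    unfolding perm_restrict_comp_disjoint(1)[OF c(2) t Diff_disjoint order_refl]
    by (rule perm_restrict_id[OF t])
qed

lemma sum_permutes_cyclic_perms:
  fixes F :: "('a \<Rightarrow> 'a) \<Rightarrow> 'b::comm_monoid_add"
  assumes fin: "finite S" and v: "v \<in> S"
  shows "(\<Sum>s | s permutes S. F s)
    = (\<Sum>c\<in>cyclic_perms S v. \<Sum>t | t permutes (S - orbit c v). F (c \<circ> t))"
proof -
  let ?P = "\<lambda>c. {t. t permutes (S - orbit c v)}"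
  have "(\<Sum>s | s permutes S. F s) = (\<Sum>(c, t)\<in>Sigma (cyclic_perms S v) ?P. F (c \<circ> t))"
  proof (rule sum.reindex_bij_witness[where i = "\<lambda>(c, t). c \<circ> t"
        and j = "\<lambda>s. (perm_restrict s (orbit s v), perm_restrict s (S - orbit s v))"])
    fix s assume "s \<in> {s. s permutes S}"
    then have "s permutes S" by simp
    note s = perm_restrict_orbit_decomposition[OF fin this v]
    let ?c = "perm_restrict s (orbit s v)" and ?t = "perm_restrict s (S - orbit s v)"
    have "orbit ?c v = orbit s v" by (rule orbit_cyclic_eq3[OF s(3,1)])
    then show "(?c, ?t) \<in> Sigma (cyclic_perms S v) ?P"
      unfolding cyclic_perms_def using s(2,4,5) by simp
    show "(case (?c, ?t) of (c, t) \<Rightarrow> c \<circ> t) = s" using s(6) by simp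
    then show "(case (?c, ?t) of (c, t) \<Rightarrow> F (c \<circ> t)) = F s" by simp
  next
    fix x assume "x \<in> Sigma (cyclic_perms S v) ?P"
    then obtain c t where x: "x = (c, t)" and c: "c \<in> cyclic_perms S v"
      and t: "t permutes (S - orbit c v)" by blast
    let ?s = "case x of (c, t) \<Rightarrow> c \<circ> t"
    show "(perm_restrict ?s (orbit ?s v), perm_restrict ?s (S - orbit ?s v)) = x"
      unfolding x prod.case orbit_restrict_comp_disjoint[OF fin c t] ..
    have "c permutes S" "t permutes S"
      using permutes_subset[OF cyclic_permsD(2,1)[OF fin c]] permutes_subset[OF t] by auto
    then show "?s \<in> {s. s permutes S}" unfolding x by (simp add: permutes_compose)
  qed
  also have "\<dots> = (\<Sum>c\<in>cyclic_perms S v. \<Sum>t\<in>?P c. F (c \<circ> t))"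
    using fin
    by (intro sum.Sigma[symmetric]) (auto intro: finite_cyclic_perms finite_permutations)
  finally show ?thesis .
qed

lemma prod_comp_disjoint:
  fixes h :: "'a \<Rightarrow> 'a \<Rightarrow> 'b::comm_monoid_mult"
  assumes "finite S" "C \<subseteq> S" "c permutes C" "t permutes (S - C)"
  shows "(\<Prod>i\<in>S. h i ((c \<circ> t) i)) = (\<Prod>i\<in>C. h i (c i)) * (\<Prod>i\<in>S - C. h i (t i))"
proof -
  note ct = comp_permutes_disjoint[OF assms(3,4) Diff_disjoint]
  have "(\<Prod>i\<in>S. h i ((c \<circ> t) i)) = (\<Prod>i\<in>S - C. h i ((c \<circ> t) i)) * (\<Prod>i\<in>C. h i ((c \<circ> t) i))"
    by (rule prod.subset_diff[OF assms(2,1)])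
  also have "(\<Prod>i\<in>S - C. h i ((c \<circ> t) i)) = (\<Prod>i\<in>S - C. h i (t i))"
    by (intro prod.cong refl arg_cong[where f = "h _"] ct(2)) simp
  also have "(\<Prod>i\<in>C. h i ((c \<circ> t) i)) = (\<Prod>i\<in>C. h i (c i))"
    by (intro prod.cong refl arg_cong[where f = "h _"] ct(1))
  finally show ?thesis by (simp only: mult.commute)
qed

theorem hook_immanant_on_expand:
  assumes fin: "finite S" and v: "v \<in> S"
  shows "hook_immanant_on S k h = (\<Sum>c\<in>cyclic_perms S v. (\<Prod>i\<in>orbit c v. h i (c i)) *
    (hook_immanant_on (S - orbit c v) (k - int (card (orbit c v))) h
      - (-1) ^ card (orbit c v) * hook_immanant_on (S - orbit c v) k h))"
  unfolding hook_immanant_on_def[of S] sum_permutes_cyclic_perms[OF assms]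
proof (rule sum.cong[OF refl])
  fix c assume "c \<in> cyclic_perms S v"
  note c = cyclic_permsD[OF fin this]
  let ?C = "orbit c v"
  have "(\<Sum>t | t permutes (S - ?C). hook_char S (c \<circ> t) k * (\<Prod>i\<in>S. h i ((c \<circ> t) i)))
    = (\<Sum>t | t permutes (S - ?C). (\<Prod>i\<in>?C. h i (c i)) *
        (hook_char (S - ?C) t (k - int (card ?C)) * (\<Prod>i\<in>S - ?C. h i (t i))
          - (-1) ^ card ?C * (hook_char (S - ?C) t k * (\<Prod>i\<in>S - ?C. h i (t i)))))"
  proof (rule sum.cong[OF refl])
    fix t assume "t \<in> {t. t permutes (S - ?C)}"
    then have t: "t permutes (S - ?C)" by simp
    show "hook_char S (c \<circ> t) k * (\<Prod>i\<in>S. h i ((c \<circ> t) i)) = (\<Prod>i\<in>?C. h i (c i)) *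
        (hook_char (S - ?C) t (k - int (card ?C)) * (\<Prod>i\<in>S - ?C. h i (t i))
          - (-1) ^ card ?C * (hook_char (S - ?C) t k * (\<Prod>i\<in>S - ?C. h i (t i))))"
      unfolding prod_comp_disjoint[OF fin c(1,2) t] hook_char_cyclic_comp[OF fin c(1,2,4) t]
      by (simp only: left_diff_distrib right_diff_distrib mult_ac)
  qed
  then show "(\<Sum>t | t permutes (S - ?C). hook_char S (c \<circ> t) k * (\<Prod>i\<in>S. h i ((c \<circ> t) i)))
    = (\<Prod>i\<in>?C. h i (c i)) * (hook_immanant_on (S - ?C) (k - int (card ?C)) h
        - (-1) ^ card ?C * hook_immanant_on (S - ?C) k h)"
    unfolding hook_immanant_on_def by (simp only: sum_distrib_left flip: sum_subtractf)
qed

lemma hook_immanant_eq: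
  "hook_immanant k M = hook_immanant_on {0..<dim_row M} k (\<lambda>i j. M $$ (i, j))"
proof -
  let ?m = "dim_row M"
  consider "1 \<le> k" "k \<le> int ?m" | "?m = 0" "k \<le> 0" | "?m \<noteq> 0" "k \<le> 0" | "k > int ?m" by linarith
  then show ?thesis
  proof cases
    case 1
    then have "irr_char (hook (nat k) ?m) s = hook_char {0..<?m} s k"
      if "s permutes {0..<?m}" for s
      using irr_char_hook[OF _ _ that, of "nat k"] by simp
    then show ?thesis using 1 by (simp add: hook_immanant_def hook_immanant_on_def Let_def)
  next
    case 2
    have "perm_restrict id {} = (id :: nat \<Rightarrow> nat)" by (auto simp: perm_restrict_def)
    moreover have "invariant_sets {} id = {{} :: nat set}" by (auto simp: invariant_sets_def)
    ultimately have "hook_char ({} :: nat set) id k = (-1) ^ nat (- k)"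
      using 2 by (simp add: hook_char_def hook_weight_def geometric_coeff_def)
    then show ?thesis using 2 by (simp add: hook_immanant_def hook_immanant_on_def Let_def)
  next
    case 3
    then have "hook_char {0..<?m} s k = 0" if "s permutes {0..<?m}" for s
      using that by (intro hook_char_nonpos) auto
    then show ?thesis using 3 by (simp add: hook_immanant_def hook_immanant_on_def Let_def)
  next
    case 4
    then have "hook_char {0..<?m} s k = 0" for s by (intro hook_char_greater) auto
    then show ?thesis using 4 by (simp add: hook_immanant_def hook_immanant_on_def Let_def)
  qed
qed

lemma hook_poly_eq:
  assumes M: "M \<in> carrier_mat m m" and f: "bij_betw f {0..<m} S"
    and h: "\<And>i j. i < m \<Longrightarrow> j < m \<Longrightarrow> h (f i) (f j) = (if i = j then x else 0) - M $$ (i, j)"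
  shows "hook_poly k M x = hook_immanant_on S k h"
proof -
  have "hook_poly k M x = hook_immanant_on {0..<m} k (\<lambda>i j. (x \<cdot>\<^sub>m 1\<^sub>m m - M) $$ (i, j))"
    unfolding hook_poly_def hook_immanant_eq using M by simp
  also have "\<dots> = hook_immanant_on {0..<m} k (\<lambda>i j. h (f i) (f j))"
    by (rule hook_immanant_on_cong) (use M h in auto)
  also have "\<dots> = hook_immanant_on S k h"
    by (rule hook_immanant_on_reindex[OF _ f, symmetric]) simp
  finally show ?thesis .
qed

section \<open>Matrices of digraphs\<close>

lemma bij_betw_pick:
  assumes "finite I"
  shows "bij_betw (pick I) {0..<card I} I"
proof (rule bij_betw_byWitness[where f' = "\<lambda>i. card {a \<in> I. a < i}"])
  show "\<forall>n\<in>{0..<card I}. card {a \<in> I. a < pick I n} = n" by (simp add: card_pick)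
  show "\<forall>i\<in>I. pick I (card {a \<in> I. a < i}) = i" by (simp add: pick_card_in_set)
  show "pick I ` {0..<card I} \<subseteq> I" by (auto simp: pick_in_set)
  show "(\<lambda>i. card {a \<in> I. a < i}) ` I \<subseteq> {0..<card I}"
    using assms by (auto intro!: psubset_card_mono)
qed

definition char_entry :: "real \<Rightarrow> real \<Rightarrow> ('a, 'b) pre_digraph \<Rightarrow> real \<Rightarrow> 'a \<Rightarrow> 'a \<Rightarrow> real" where
  "char_entry \<beta> \<gamma> G x u w = (if u = w then x - \<beta> * real (out_degree G u) else 0)
     - (if (u, w) \<in> arcs_ends G then \<gamma> else 0)"

lemma H_mat_carrier: "H_mat \<beta> \<gamma> G vs \<in> carrier_mat (length vs) (length vs)"
  by (simp add: H_mat_def out_deg_mat_def adj_mat_def mat_diag_def carrier_matI)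

lemma H_mat_index:
  assumes "i < length vs" "j < length vs"
  shows "H_mat \<beta> \<gamma> G vs $$ (i, j) = (if i = j then \<beta> * real (out_degree G (vs ! i)) else 0)
    + (if (vs ! i, vs ! j) \<in> arcs_ends G then \<gamma> else 0)"
  using assms by (simp add: H_mat_def out_deg_mat_def adj_mat_def mat_diag_def)

lemma char_entry_nth:
  assumes "distinct vs" "i < length vs" "j < length vs"
  shows "char_entry \<beta> \<gamma> G x (vs ! i) (vs ! j)
    = (if i = j then x else 0) - H_mat \<beta> \<gamma> G vs $$ (i, j)"
  using assms by (simp add: char_entry_def H_mat_index nth_eq_iff_index_eq)

definition indices_outside :: "'a list \<Rightarrow> 'a set \<Rightarrow> nat set" where
  "indices_outside vs S = {i. i < length vs \<and> vs ! i \<notin> S}"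

lemma pick_indices_outside:
  assumes "i < card (indices_outside vs S)"
  shows "pick (indices_outside vs S) i < length vs" "vs ! pick (indices_outside vs S) i \<notin> S"
  using pick_in_set[of i "indices_outside vs S"] assms unfolding indices_outside_def by auto

lemma H_del_carrier:
  "H_del \<beta> \<gamma> G vs S \<in> carrier_mat (card (indices_outside vs S)) (card (indices_outside vs S))"
  using H_mat_carrier[of \<beta> \<gamma> G vs]
  by (auto simp: H_del_def Let_def dim_submatrix indices_outside_def intro!: carrier_matI
      arg_cong[where f = card])

lemma H_del_index:
  assumes "i < card (indices_outside vs S)" "j < card (indices_outside vs S)"
  shows "H_del \<beta> \<gamma> G vs S $$ (i, j)
    = H_mat \<beta> \<gamma> G vs $$ (pick (indices_outside vs S) i, pick (indices_outside vs S) j)"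
proof -
  have "{i. i < length vs \<and> i \<in> indices_outside vs S} = indices_outside vs S"
    unfolding indices_outside_def by auto
  then show ?thesis
    using assms H_mat_carrier[of \<beta> \<gamma> G vs]
    unfolding H_del_def Let_def indices_outside_def[symmetric]
    by (intro submatrix_index) simp_all
qed

lemma hook_poly_H_mat:
  assumes "distinct vs" "set vs = verts G"
  shows "hook_poly k (H_mat \<beta> \<gamma> G vs) x = hook_immanant_on (verts G) k (char_entry \<beta> \<gamma> G x)"
proof (rule hook_poly_eq[OF H_mat_carrier])
  show "bij_betw ((!) vs) {0..<length vs} (verts G)"
    using assms by (intro bij_betw_nth) auto
qed (rule char_entry_nth[OF assms(1)])

lemma hook_poly_H_del:
  assumes "distinct vs" "set vs = verts G"
  shows "hook_poly k (H_del \<beta> \<gamma> G vs S) x = hook_immanant_on (verts G - S) k (char_entry \<beta> \<gamma> G x)"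
proof (rule hook_poly_eq[OF H_del_carrier])
  let ?I = "indices_outside vs S"
  have pick: "bij_betw (pick ?I) {0..<card ?I} ?I"
    by (rule bij_betw_pick) (simp add: indices_outside_def)
  have "inj_on ((!) vs) ?I"
    using assms(1) by (auto simp: inj_on_def indices_outside_def nth_eq_iff_index_eq)
  moreover have "(!) vs ` ?I = verts G - S"
    unfolding assms(2)[symmetric] indices_outside_def by (auto simp: in_set_conv_nth)
  ultimately have "bij_betw ((!) vs) ?I (verts G - S)" by (rule bij_betw_imageI)
  then show "bij_betw ((!) vs \<circ> pick ?I) {0..<card ?I} (verts G - S)"
    by (rule bij_betw_trans[OF pick])
  fix i j assume ij: "i < card ?I" "j < card ?I"
  have "pick ?I i = pick ?I j \<longleftrightarrow> i = j"
    using inj_on_eq_iff[OF bij_betw_imp_inj_on[OF pick], of i j] ij by simp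
  then show "char_entry \<beta> \<gamma> G x (((!) vs \<circ> pick ?I) i) (((!) vs \<circ> pick ?I) j)
      = (if i = j then x else 0) - H_del \<beta> \<gamma> G vs S $$ (i, j)"
    by (simp only: o_apply H_del_index[OF ij]
        char_entry_nth[OF assms(1) pick_indices_outside(1)[OF ij(1)]
          pick_indices_outside(1)[OF ij(2)]])
qed

lemma (in wf_digraph) H_del_del_arc:
  assumes "tail G e \<in> S"
  shows "H_del \<beta> \<gamma> (del_arc e) vs S = H_del \<beta> \<gamma> G vs S"
proof (rule eq_matI)
  let ?I = "indices_outside vs S"
  fix i j assume "i < dim_row (H_del \<beta> \<gamma> G vs S)" "j < dim_col (H_del \<beta> \<gamma> G vs S)"
  then have ij: "i < card ?I" "j < card ?I" using H_del_carrier[of \<beta> \<gamma> G vs S] by auto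
  note I = pick_indices_outside[OF ij(1)] pick_indices_outside[OF ij(2)]
  have u: "tail G e \<noteq> vs ! pick ?I i" using I(2) assms by metis
  then have "out_degree (del_arc e) (vs ! pick ?I i) = out_degree G (vs ! pick ?I i)"
    by (simp add: out_degree_def out_arcs_del_arc_iff)
  moreover have "(vs ! pick ?I i, w) \<in> arcs_ends (del_arc e)
      \<longleftrightarrow> (vs ! pick ?I i, w) \<in> arcs_ends G" for w
    using u unfolding arcs_ends_conv by auto
  ultimately show "H_del \<beta> \<gamma> (del_arc e) vs S $$ (i, j) = H_del \<beta> \<gamma> G vs S $$ (i, j)"
    unfolding H_del_index[OF ij] H_mat_index[OF I(1,3)] by (simp only:)
qed (use H_del_carrier[of \<beta> \<gamma> _ vs S] in \<open>metis carrier_matD\<close>)+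

section \<open>Directed cycles and cyclic permutations\<close>

lemma (in pre_digraph) cas_iff:
  "cas u p v \<longleftrightarrow> u # map (head G) p = map (tail G) p @ [v]"
  by (induction p arbitrary: u) auto

lemma (in wf_digraph) cycle_iff:
  "cycle p \<longleftrightarrow> p \<noteq> [] \<and> set p \<subseteq> arcs G \<and> distinct (map (tail G) p)
    \<and> map (head G) p = rotate1 (map (tail G) p)"
proof (cases p)
  case (Cons e es)
  have "cas u p u \<longleftrightarrow> u = tail G e \<and> map (head G) p = rotate1 (map (tail G) p)" for u
    unfolding cas_iff Cons by auto
  moreover have "distinct (tl (awalk_verts u p)) \<longleftrightarrow> distinct (map (tail G) p)"
    if "cas u p u" "map (head G) p = rotate1 (map (tail G) p)" for u
    using awalk_verts_conv'[OF that(1)] Cons that(2)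
    by (metis distinct1_rotate list.distinct(1) list.sel(3))
  moreover have "tail G e \<in> verts G" if "set p \<subseteq> arcs G" using that Cons by auto
  ultimately show ?thesis unfolding cycle_def awalk_def using Cons by blast
qed (simp add: cycle_def)

definition perm_arcs :: "('a, 'b) pre_digraph \<Rightarrow> ('a \<Rightarrow> 'a) \<Rightarrow> 'b set" where
  "perm_arcs G c = {e \<in> arcs G. head G e = c (tail G e)}"

definition dicycle_perms :: "('a, 'b) pre_digraph \<Rightarrow> 'a \<Rightarrow> ('a \<Rightarrow> 'a) set" where
  "dicycle_perms G v = {c \<in> cyclic_perms (verts G) v. \<forall>i\<in>orbit c v. (i, c i) \<in> arcs_ends G}"

context digraph
begin

lemma dicycle_permsD:
  assumes "c \<in> dicycle_perms G v"
  shows "c \<in> cyclic_perms (verts G) v"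
    "i \<in> orbit c v \<Longrightarrow> \<exists>e. e \<in> arcs G \<and> tail G e = i \<and> head G e = c i"
  using assms unfolding dicycle_perms_def arcs_ends_conv by force+

lemma arc_eqI: "e \<in> arcs G \<Longrightarrow> e' \<in> arcs G \<Longrightarrow> tail G e = tail G e' \<Longrightarrow> head G e = head G e' \<Longrightarrow> e = e'"
  using no_multi_arcs unfolding arc_to_ends_def by simp

lemma tail_in_permuted:
  assumes "c permutes C" "e \<in> perm_arcs G c"
  shows "tail G e \<in> C"
proof (rule ccontr)
  assume "tail G e \<notin> C"
  then have "head G e = tail G e" using assms permutes_not_in unfolding perm_arcs_def by fastforce
  then show False using assms(2) no_loops unfolding perm_arcs_def by force
qed

lemma cycle_verts_perm_arcs:
  assumes "c \<in> dicycle_perms G v"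
  shows "cycle_verts G (perm_arcs G c) = orbit c v"
  unfolding cycle_verts_def
proof
  note c = cyclic_permsD[OF finite_verts dicycle_permsD(1)[OF assms]]
  show "tail G ` perm_arcs G c \<subseteq> orbit c v" using tail_in_permuted[OF c(2)] by blast
  show "orbit c v \<subseteq> tail G ` perm_arcs G c"
    using dicycle_permsD(2)[OF assms] unfolding perm_arcs_def by force
qed

lemma inj_on_perm_arcs: "inj_on (perm_arcs G) (dicycle_perms G v)"
proof (rule inj_onI)
  fix c d assume c: "c \<in> dicycle_perms G v" and d: "d \<in> dicycle_perms G v"
    and eq: "perm_arcs G c = perm_arcs G d"
  have orbit: "orbit c v = orbit d v"
    using cycle_verts_perm_arcs[OF c] cycle_verts_perm_arcs[OF d] eq by simp
  show "c = d"
  proof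
    fix i show "c i = d i"
    proof (cases "i \<in> orbit c v")
      case True
      then obtain e where e: "e \<in> arcs G" "tail G e = i" "head G e = c i"
        using dicycle_permsD(2)[OF c] by blast
      then have "e \<in> perm_arcs G d" using eq unfolding perm_arcs_def by blast
      then show ?thesis using e unfolding perm_arcs_def by simp
    next
      case False
      then show ?thesis
        using orbit cyclic_permsD(2)[OF finite_verts dicycle_permsD(1)[OF c]]
          cyclic_permsD(2)[OF finite_verts dicycle_permsD(1)[OF d]] by (simp add: permutes_not_in)
    qed
  qed
qed

lemma perm_arcs_in_cycles_at_vertex:
  assumes "c \<in> dicycle_perms G v"
  shows "perm_arcs G c \<in> cycles_at_vertex G v"
proof -
  note c = cyclic_permsD[OF finite_verts dicycle_permsD(1)[OF assms]]
  obtain cs where cs: "distinct cs" "set cs = orbit c v" "c = cycle_of_list cs"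
    using ex_cycle_of_list[OF c(2-4)] .
  obtain a where a: "a i \<in> arcs G" "tail G (a i) = i" "head G (a i) = c i"
    if "i \<in> orbit c v" for i
    using dicycle_permsD(2)[OF assms] by metis
  let ?p = "map a cs"
  have tails: "map (tail G) ?p = cs" using a(2) cs(2) by (auto intro: map_idI)
  have "map (head G) ?p = map c cs" using a(3) cs(2) by simp
  also have "\<dots> = rotate1 cs" using cyclic_rotation[OF cs(1), of 1] cs(3) by simp
  finally have "map (head G) ?p = rotate1 (map (tail G) ?p)" unfolding tails .
  moreover have "set ?p \<subseteq> arcs G" using a(1) cs(2) by auto
  moreover have "?p \<noteq> []" using c(5) cs(2) by auto
  ultimately have "cycle ?p" unfolding cycle_iff tails using cs(1) by blast
  moreover have "set ?p = perm_arcs G c"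
  proof
    show "set ?p \<subseteq> perm_arcs G c" using a cs(2) unfolding perm_arcs_def by auto
    show "perm_arcs G c \<subseteq> set ?p"
    proof
      fix e assume e: "e \<in> perm_arcs G c"
      have orbit: "tail G e \<in> orbit c v" by (rule tail_in_permuted[OF c(2) e])
      have "e = a (tail G e)"
        using e a[OF orbit] by (intro arc_eqI) (simp_all add: perm_arcs_def)
      then show "e \<in> set ?p" using orbit cs(2) by auto
    qed
  qed
  ultimately show ?thesis
    unfolding cycles_at_vertex_def dicycles_def cycle_verts_perm_arcs[OF assms, symmetric]
    using c(5) cycle_verts_perm_arcs[OF assms] by blast
qed

lemma cycles_at_vertex_subset: "cycles_at_vertex G v \<subseteq> perm_arcs G ` dicycle_perms G v"
proof
  fix C assume "C \<in> cycles_at_vertex G v"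
  then obtain p where C: "C = set p" and "cycle p" and v: "v \<in> tail G ` set p"
    unfolding cycles_at_vertex_def dicycles_def cycle_verts_def by blast
  let ?ts = "map (tail G) p"
  have arcs: "set p \<subseteq> arcs G" and dist: "distinct ?ts" and heads: "map (head G) p = rotate1 ?ts"
    using \<open>cycle p\<close> unfolding cycle_iff by auto
  define c where "c = cycle_of_list ?ts"
  have "map c ?ts = map (head G) p"
    using cyclic_rotation[OF dist, of 1] unfolding c_def heads by simp
  then have c_tail: "c (tail G e) = head G e" if "e \<in> set p" for e using that by simp
  have perm: "c permutes set ?ts" unfolding c_def by (rule cycle_permutes)
  have orbit: "orbit c v = set ?ts"
    unfolding c_def using v by (intro orbit_cycle_of_list[OF dist]) simp
  have "c \<in> dicycle_perms G v"
    unfolding dicycle_perms_def cyclic_perms_def mem_Collect_eq orbit arcs_ends_conv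
    using perm arcs c_tail by auto
  moreover have "perm_arcs G c = C"
  proof
    show "C \<subseteq> perm_arcs G c" unfolding C perm_arcs_def using c_tail arcs by auto
    show "perm_arcs G c \<subseteq> C"
    proof
      fix e assume e: "e \<in> perm_arcs G c"
      obtain e' where e': "e' \<in> set p" "tail G e = tail G e'"
        using tail_in_permuted[OF perm e] by auto
      then have "e = e'"
        using e c_tail[OF e'(1)] arcs unfolding perm_arcs_def by (intro arc_eqI) auto
      then show "e \<in> C" using e'(1) C by simp
    qed
  qed
  ultimately show "C \<in> perm_arcs G ` dicycle_perms G v" by blast
qed

lemma bij_betw_perm_arcs: "bij_betw (perm_arcs G) (dicycle_perms G v) (cycles_at_vertex G v)"
  using inj_on_perm_arcs perm_arcs_in_cycles_at_vertex cycles_at_vertex_subset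
  by (intro bij_betw_imageI) blast+

lemma finite_dicycle_perms: "finite (dicycle_perms G v)"
  using finite_cyclic_perms[OF finite_verts] unfolding dicycle_perms_def by simp

lemma finite_cycles_at_vertex: "finite (cycles_at_vertex G v)"
  using bij_betw_finite[OF bij_betw_perm_arcs] finite_dicycle_perms by blast

lemma no_loop_arcs_ends: "(i, i) \<notin> arcs_ends G"
  using adj_not_same by blast

lemma cyclic_perm_no_fixpoint:
  assumes "c \<in> cyclic_perms (verts G) v" "c \<noteq> id" "i \<in> orbit c v"
  shows "c i \<noteq> i"
proof
  note c = cyclic_permsD[OF finite_verts assms(1)]
  assume "c i = i"
  then have "orbit c i = {i}" by (simp add: orbit_eq_singleton_iff)
  then have "orbit c v = {i}" using orbit_cyclic_eq3[OF c(4) assms(3)] by simp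
  then show False using c(2) assms(2) by simp
qed

lemma id_cyclic_perms:
  assumes "v \<in> verts G"
  shows "id \<in> cyclic_perms (verts G) v" "id \<notin> dicycle_perms G v"
proof -
  have "orbit id v = {v}" by (simp add: orbit_eq_singleton_iff)
  then show "id \<in> cyclic_perms (verts G) v" "id \<notin> dicycle_perms G v"
    using assms no_loop_arcs_ends by (auto simp: cyclic_perms_def dicycle_perms_def permutes_id)
qed

lemma prod_char_entry:
  assumes "c \<in> dicycle_perms G v"
  shows "(\<Prod>i\<in>orbit c v. char_entry \<beta> \<gamma> G x i (c i)) = (- \<gamma>) ^ card (orbit c v)"
proof -
  have "char_entry \<beta> \<gamma> G x i (c i) = - \<gamma>" if "i \<in> orbit c v" for i
  proof -
    have arc: "(i, c i) \<in> arcs_ends G" using assms that unfolding dicycle_perms_def by blast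
    then have "i \<noteq> c i" using no_loop_arcs_ends by metis
    then show ?thesis using arc by (simp add: char_entry_def)
  qed
  then show ?thesis by simp
qed

lemma prod_char_entry_eq_0:
  assumes "c \<in> cyclic_perms (verts G) v" "c \<noteq> id" "c \<notin> dicycle_perms G v"
  shows "(\<Prod>i\<in>orbit c v. char_entry \<beta> \<gamma> G x i (c i)) = 0"
proof -
  obtain i where i: "i \<in> orbit c v" "(i, c i) \<notin> arcs_ends G"
    using assms(1,3) unfolding dicycle_perms_def by blast
  then have "char_entry \<beta> \<gamma> G x i (c i) = 0"
    using cyclic_perm_no_fixpoint[OF assms(1,2) i(1)] by (simp add: char_entry_def)
  then show ?thesis
    using i(1) cyclic_permsD(3)[OF finite_verts assms(1)] by (intro prod_zero) auto
qed

end

section \<open>Expansion along a vertex and along an arc\<close>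

definition cycle_term ::
  "real \<Rightarrow> real \<Rightarrow> ('a, 'b) pre_digraph \<Rightarrow> 'a list \<Rightarrow> int \<Rightarrow> real \<Rightarrow> 'b set \<Rightarrow> real" where
  "cycle_term \<beta> \<gamma> G vs k x C = \<gamma> ^ card (cycle_verts G C) *
     ((-1) ^ card (cycle_verts G C) *
        hook_poly (k - int (card (cycle_verts G C))) (H_del \<beta> \<gamma> G vs (cycle_verts G C)) x
      - hook_poly k (H_del \<beta> \<gamma> G vs (cycle_verts G C)) x)"

lemma (in digraph) hook_poly_expand_vertex:
  assumes vs: "distinct vs" "set vs = verts G" and v: "v \<in> verts G"
  shows "hook_poly k (H_mat \<beta> \<gamma> G vs) x = (x - \<beta> * real (out_degree G v)) *
      (hook_poly (k - 1) (H_del \<beta> \<gamma> G vs {v}) x + hook_poly k (H_del \<beta> \<gamma> G vs {v}) x)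
    + (\<Sum>C\<in>cycles_at_vertex G v. cycle_term \<beta> \<gamma> G vs k x C)"
proof -
  let ?h = "char_entry \<beta> \<gamma> G x" and ?P = "cyclic_perms (verts G) v"
  let ?g = "\<lambda>c. (\<Prod>i\<in>orbit c v. ?h i (c i)) *
    (hook_immanant_on (verts G - orbit c v) (k - int (card (orbit c v))) ?h
      - (-1) ^ card (orbit c v) * hook_immanant_on (verts G - orbit c v) k ?h)"
  note fin = finite_cyclic_perms[OF finite_verts, of v]
  have signs: "(- \<gamma>) ^ n * (a - (-1) ^ n * b) = \<gamma> ^ n * ((-1) ^ n * a - b)" for n and a b :: real
    by (cases "even n") (simp_all add: algebra_simps)
  have "hook_poly k (H_mat \<beta> \<gamma> G vs) x = sum ?g ?P"
    unfolding hook_poly_H_mat[OF vs] by (rule hook_immanant_on_expand[OF finite_verts v])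
  also have "\<dots> = ?g id + sum ?g (?P - {id})"
    by (rule sum.remove[OF fin id_cyclic_perms(1)[OF v]])
  also have "sum ?g (?P - {id}) = sum ?g (dicycle_perms G v)"
    using fin prod_char_entry_eq_0 id_cyclic_perms(2)[OF v] dicycle_permsD(1)
    by (intro sum.mono_neutral_right) auto
  also have "\<dots> = (\<Sum>c\<in>dicycle_perms G v. cycle_term \<beta> \<gamma> G vs k x (perm_arcs G c))"
  proof (rule sum.cong[OF refl])
    fix c assume c: "c \<in> dicycle_perms G v"
    show "?g c = cycle_term \<beta> \<gamma> G vs k x (perm_arcs G c)"
      unfolding prod_char_entry[OF c] cycle_term_def cycle_verts_perm_arcs[OF c]
        hook_poly_H_del[OF vs]
      by (rule signs)
  qed
  also have "\<dots> = (\<Sum>C\<in>cycles_at_vertex G v. cycle_term \<beta> \<gamma> G vs k x C)"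
    by (rule sum.reindex_bij_betw[OF bij_betw_perm_arcs])
  also have "?g id = (x - \<beta> * real (out_degree G v)) *
      (hook_poly (k - 1) (H_del \<beta> \<gamma> G vs {v}) x + hook_poly k (H_del \<beta> \<gamma> G vs {v}) x)"
  proof -
    have "orbit id v = {v}" by (simp add: orbit_eq_singleton_iff)
    then show ?thesis
      unfolding hook_poly_H_del[OF vs] by (simp add: char_entry_def no_loop_arcs_ends)
  qed
  finally show ?thesis .
qed

lemma (in wf_digraph) dicycles_del_arc: "dicycles (del_arc e) = {C \<in> dicycles G. e \<notin> C}"
proof -
  interpret D: wf_digraph "del_arc e" by (rule wf_digraph_del_arc)
  have "D.cycle p \<longleftrightarrow> cycle p \<and> e \<notin> set p" for p
    unfolding cycle_iff D.cycle_iff by auto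
  then show ?thesis unfolding dicycles_def by auto
qed

lemma (in digraph) digraph_del_arc: "digraph (del_arc e)"
proof -
  interpret D: fin_digraph "del_arc e" by (rule fin_digraph_del_arc)
  show ?thesis
    by unfold_locales (use no_loops no_multi_arcs in \<open>auto simp: arc_to_ends_def\<close>)
qed

lemma cycle_verts_del_arc: "cycle_verts (pre_digraph.del_arc G e) = cycle_verts G"
  by (simp add: cycle_verts_def pre_digraph.del_arc_simps fun_eq_iff)

lemma (in wf_digraph) cycle_term_del_arc:
  assumes "tail G e \<in> cycle_verts G C"
  shows "cycle_term \<beta> \<gamma> (del_arc e) vs k x C = cycle_term \<beta> \<gamma> G vs k x C"
  unfolding cycle_term_def cycle_verts_del_arc H_del_del_arc[OF assms] ..

lemma (in wf_digraph) cycles_at_vertex_tail: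
  "cycles_at_vertex G (tail G e) = cycles_at_vertex (del_arc e) (tail G e) \<union> cycles_at_arc G e"
  "cycles_at_vertex (del_arc e) (tail G e) \<inter> cycles_at_arc G e = {}"
  unfolding cycles_at_vertex_def cycles_at_arc_def dicycles_del_arc cycle_verts_del_arc
  by (auto simp: cycle_verts_def)

lemma (in digraph) hook_poly_expand_arc:
  assumes vs: "distinct vs" "set vs = verts G" and e: "e \<in> arcs G"
  shows "hook_poly k (H_mat \<beta> \<gamma> G vs) x = hook_poly k (H_mat \<beta> \<gamma> (del_arc e) vs) x
    - \<beta> * (hook_poly k (H_del \<beta> \<gamma> (del_arc e) vs {tail G e}) x
           + hook_poly (k - 1) (H_del \<beta> \<gamma> (del_arc e) vs {tail G e}) x)
    + (\<Sum>C\<in>cycles_at_arc G e. cycle_term \<beta> \<gamma> G vs k x C)"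
proof -
  interpret D: digraph "del_arc e" by (rule digraph_del_arc)
  let ?v = "tail G e" and ?t = "cycle_term \<beta> \<gamma> G vs k x"
  let ?A = "hook_poly (k - 1) (H_del \<beta> \<gamma> G vs {?v}) x + hook_poly k (H_del \<beta> \<gamma> G vs {?v}) x"
  have v: "?v \<in> verts G" using e by simp
  have "e \<in> out_arcs G ?v" using e by simp
  then have "0 < out_degree G ?v"
    unfolding out_degree_def using finite_out_arcs card_gt_0_iff by blast
  then have deg: "real (out_degree (del_arc e) ?v) = real (out_degree G ?v) - 1"
    using e by (simp add: out_degree_del_arc_iff)
  have "sum ?t (cycles_at_vertex G ?v)
      = sum ?t (cycles_at_vertex (del_arc e) ?v) + sum ?t (cycles_at_arc G e)"
    unfolding cycles_at_vertex_tail(1) using finite_cycles_at_vertex[of ?v] cycles_at_vertex_tail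
    by (intro sum.union_disjoint) simp_all
  then have expand_G: "hook_poly k (H_mat \<beta> \<gamma> G vs) x = (x - \<beta> * real (out_degree G ?v)) * ?A
      + (sum ?t (cycles_at_vertex (del_arc e) ?v) + sum ?t (cycles_at_arc G e))"
    using hook_poly_expand_vertex[OF vs v] by simp
  have "sum (cycle_term \<beta> \<gamma> (del_arc e) vs k x) (cycles_at_vertex (del_arc e) ?v)
      = sum ?t (cycles_at_vertex (del_arc e) ?v)"
    by (intro sum.cong refl cycle_term_del_arc)
      (simp add: cycles_at_vertex_def cycle_verts_del_arc)
  then have "hook_poly k (H_mat \<beta> \<gamma> (del_arc e) vs) x
      = (x - \<beta> * (real (out_degree G ?v) - 1)) * ?A + sum ?t (cycles_at_vertex (del_arc e) ?v)"
    using D.hook_poly_expand_vertex[OF vs(1), of ?v] vs(2) v by (simp add: deg H_del_del_arc)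
  then show ?thesis unfolding expand_G H_del_del_arc[OF singletonI] by (simp add: ring_distribs)
qed

theorem theorem1p3:
  fixes G :: "('a, 'b) pre_digraph" and vs :: "'a list"
    and \<beta> \<gamma> x :: real and k :: int
  assumes "digraph G" and "distinct vs" and "set vs = verts G"
  shows
    "(\<forall>v\<in>verts G.
        hook_poly k (H_mat \<beta> \<gamma> G vs) x =
          (x - \<beta> * real (out_degree G v)) *
            (hook_poly (k - 1) (H_del \<beta> \<gamma> G vs {v}) x + hook_poly k (H_del \<beta> \<gamma> G vs {v}) x)
          + (\<Sum>C\<in>cycles_at_vertex G v. \<gamma> ^ card (cycle_verts G C) *
               ((-1) ^ card (cycle_verts G C) *
                  hook_poly (k - int (card (cycle_verts G C))) (H_del \<beta> \<gamma> G vs (cycle_verts G C)) x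
                - hook_poly k (H_del \<beta> \<gamma> G vs (cycle_verts G C)) x)))
     \<and>
     (\<forall>e v u. e \<in> arcs G \<and> tail G e = v \<and> head G e = u \<longrightarrow>
        hook_poly k (H_mat \<beta> \<gamma> G vs) x =
          hook_poly k (H_mat \<beta> \<gamma> (pre_digraph.del_arc G e) vs) x
          - \<beta> * (hook_poly k (H_del \<beta> \<gamma> (pre_digraph.del_arc G e) vs {v}) x
                 + hook_poly (k - 1) (H_del \<beta> \<gamma> (pre_digraph.del_arc G e) vs {v}) x)
          + (\<Sum>C\<in>cycles_at_arc G e. \<gamma> ^ card (cycle_verts G C) *
               ((-1) ^ card (cycle_verts G C) *
                  hook_poly (k - int (card (cycle_verts G C))) (H_del \<beta> \<gamma> G vs (cycle_verts G C)) x
                - hook_poly k (H_del \<beta> \<gamma> G vs (cycle_verts G C)) x)))"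
proof (intro conjI ballI allI impI, goal_cases)
  case (1 v)
  then show ?case by (rule digraph.hook_poly_expand_vertex[OF assms, unfolded cycle_term_def])
next
  case (2 e v u)
  then show ?case
    using digraph.hook_poly_expand_arc[OF assms, of e, unfolded cycle_term_def] by blast
qed

end
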